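(* For all positive integers $d$, $k<d$ and $p\ge k+2$ there exists a constant $C=C(d,k,p)$ such that the following holds. If $\mathcal{F}$ is a (possibly infinite) family of closed balls in $\mathbb{R}^d$ such that among any $p$ members of $\mathcal{F}$ there are $k+2$ that can be hit by a single $k$-flat, then there exist at most $C$ $k$-flats such that every ball of $\mathcal{F}$ is intersected by at least one of them.
   Context: A $k$-flat is a $k$-dimensional affine subspace of $\mathbb{R}^d$; a set is hit by a flat if they intersect. *)

theory Defs
  imports "HOL-Analysis.Analysis"
begin

definition is_flat :: "nat \<Rightarrow> 'a::euclidean_space set \<Rightarrow> bool" where
  "is_flat k V \<longleftrightarrow> affine V \<and> aff_dim V = int k"

text \<open>Balls have positive radius; \<^term>\<open>cball x 0\<close> would be a single point.\<close>

definition is_closed_ball :: "'a::metric_space set \<Rightarrow> bool" where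
  "is_closed_ball B \<longleftrightarrow> (\<exists>x r. r > 0 \<and> B = cball x r)"

definition hits :: "'a set \<Rightarrow> 'a set \<Rightarrow> bool" where
  "hits V B \<longleftrightarrow> V \<inter> B \<noteq> {}"

definition flat_pq_property :: "nat \<Rightarrow> nat \<Rightarrow> nat \<Rightarrow> 'a::euclidean_space set set \<Rightarrow> bool" where
  "flat_pq_property p q k \<F> \<longleftrightarrow>
     (\<forall>\<G>\<subseteq>\<F>. finite \<G> \<and> card \<G> = p \<longrightarrow>
        (\<exists>\<H>\<subseteq>\<G>. card \<H> = q \<and> (\<exists>V. is_flat k V \<and> (\<forall>B\<in>\<H>. hits V B))))"

end

theory Submission
  imports Defs "HOL-Real_Asymp.Real_Asymp"
begin

text \<open>Suppose that \<open>k + 2\<close> balls are hit by a \<open>k\<close>-flat, in points \<open>v i\<close>. These points satisfy an affine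
  relation with coefficients \<open>\<mu> i\<close>; if \<open>l\<close> maximizes \<open>\<bar>\<mu> i\<bar> * r i\<close>, then after suitable
  perturbations of the other points, of size comparable to the radii and taken from a finite net, any
  flat through these points still hits the ball \<open>l\<close>. Hence the \<open>p\<close>-tuples of balls, weighted by any
  product measure, yield a \<open>k\<close>-flat that hits a fixed fraction of the total weight. Multiplicative weights
  turn this into a finite list of flats such that each ball is hit by a fixed fraction of the list.
  The condition that a flat hits a ball is linear in suitable coordinates of both, so the
  Vapnik--Chervonenkis dimension is bounded and an \<open>\<epsilon>\<close>-net of bounded size exists in the list.
  Infinite families reduce to finite ones by compactness of the set of flats that hit a given ball.\<close>

section \<open>Affine relations and nets of flats\<close>

text \<open>The points in which a flat meets the balls are not determined by the balls, so a tuple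
  has infinitely many candidate flats. The net leaves a number of recipes that depends only on
  \<open>k\<close>, \<open>p\<close> and the dimension: a target position, at most
  \<open>k + 1\<close> other positions, and a net point for each position. Since the radii may
  differ arbitrarily, the net is scaled by the radius of each ball separately. A recipe does not
  look at the ball in its target position. With the other entries fixed, summing over the target
  therefore converts hitting this one ball into hitting a share of the whole family. Arbitrary
  weights are needed because a flat that is good for the uniform measure says nothing about the
  balls it misses; reweighting towards the missed balls makes the resulting list serve every ball.
  The length of that list depends on the family, and only the bound on the net removes this
  dependence.\<close>

lemma flat_through_points:
  fixes Y :: "'a::euclidean_space set"
  assumes "finite Y" "card Y \<le> k + 1" "k \<le> DIM('a)"
  shows "\<exists>V. is_flat k V \<and> Y \<subseteq> V"
proof -
  have extend: "\<exists>T. subspace T \<and> S \<subseteq> T \<and> dim T = n"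
    if "dim S \<le> n" "n \<le> DIM('a)" for S :: "'a set" and n
    using that
  proof (induction n rule: dec_induct)
    case base
    show ?case by (rule exI[of _ "span S"]) (simp add: span_superset)
  next
    case (step n)
    then obtain T where T: "subspace T" "S \<subseteq> T" "dim T = n" by auto
    then have "span T \<noteq> UNIV"
      using step.prems step.hyps by (metis dim_UNIV dim_span Suc_n_not_le_n)
    then obtain a where "a \<notin> span T" by auto
    then have "dim (span (insert a T)) = Suc n"
      using T by (simp add: dim_insert)
    then show ?case
      using T(2) by (meson span_superset subset_insertI subset_trans subspace_span)
  qed
  obtain a where a: "Y = {} \<or> a \<in> Y" by auto
  have "int (dim ((+) (- a) ` Y)) \<le> int k"
  proof (cases "Y = {}")
    case False
    then have "int (dim ((+) (- a) ` Y)) = aff_dim Y"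
      using a aff_dim_eq_dim[of a Y] by (simp add: hull_inc)
    then show ?thesis using aff_dim_le_card[OF assms(1)] assms(2) by linarith
  qed simp
  then obtain T where T: "subspace T" "(+) (- a) ` Y \<subseteq> T" "dim T = k"
    using extend assms(3) by (metis nat_int_comparison(3))
  have "is_flat k ((+) a ` T)"
    unfolding is_flat_def using T
    by (simp add: aff_dim_translation_eq aff_dim_subspace subspace_imp_affine
        flip: affine_translation)
  moreover have "Y \<subseteq> (+) a ` T"
  proof
    fix y assume "y \<in> Y"
    then have "- a + y \<in> T" using T(2) by auto
    then show "y \<in> (+) a ` T" by (auto intro: image_eqI[of _ _ "- a + y"])
  qed
  ultimately show ?thesis by blast
qed

text \<open>More than \<open>k + 1\<close> distinct points of a \<open>k\<close>-flat are affinely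
  dependent. The points are indexed because different balls may be hit in the same point; such a
  coincidence gives a relation with coefficients 1 and -1.\<close>

lemma affine_relation_of_points_in_flat:
  fixes v :: "'i \<Rightarrow> 'a::euclidean_space"
  assumes "finite I" "card I = k + 2" "is_flat k V" "\<And>i. i \<in> I \<Longrightarrow> v i \<in> V"
  shows "\<exists>\<mu>. sum \<mu> I = 0 \<and> (\<Sum>i\<in>I. \<mu> i *\<^sub>R v i) = 0 \<and> (\<exists>i\<in>I. \<mu> i \<noteq> (0::real))"
proof (cases "inj_on v I")
  case True
  have fin: "finite (v ` I)" and card: "card (v ` I) = k + 2"
    using assms(1,2) True by (auto simp: card_image)
  have "aff_dim (v ` I) \<le> int k"
    using assms(3,4) aff_dim_subset[of "v ` I" V] by (auto simp: is_flat_def)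
  then have "affine_dependent (v ` I)"
    using affine_independent_iff_card[of "v ` I"] card by linarith
  then obtain U where U: "sum U (v ` I) = 0" "\<exists>x\<in>v ` I. U x \<noteq> 0" "(\<Sum>x\<in>v ` I. U x *\<^sub>R x) = 0"
    using affine_dependent_explicit_finite[OF fin] by auto
  show ?thesis
    by (rule exI[of _ "U \<circ> v"]) (use U True in \<open>auto simp: sum.reindex o_def\<close>)
next
  case False
  then obtain i j where ij: "i \<in> I" "j \<in> I" "i \<noteq> j" "v i = v j" by (auto simp: inj_on_def)
  define \<mu> where "\<mu> x = (if x = i then 1 else 0) - (if x = j then 1 else (0::real))" for x
  have "sum \<mu> I = 0" using ij assms(1) by (simp add: \<mu>_def sum_subtractf)
  moreover have "(\<Sum>x\<in>I. \<mu> x *\<^sub>R v x) = 0"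
    using ij assms(1)
    by (simp add: \<mu>_def scaleR_left_diff_distrib sum_subtractf if_distrib[of "\<lambda>c. c *\<^sub>R _"] cong: if_cong)
  moreover have "\<mu> i \<noteq> 0" using ij by (simp add: \<mu>_def)
  ultimately show ?thesis using ij by blast
qed

lemma affine_sum_mem:
  fixes y :: "'i \<Rightarrow> 'a::real_vector"
  assumes "affine V" "sum \<alpha> J = 1" "\<And>i. i \<in> J \<Longrightarrow> y i \<in> V"
  shows "(\<Sum>i\<in>J. \<alpha> i *\<^sub>R y i) \<in> V"
proof -
  have "J \<noteq> {}" using assms(2) by auto
  then obtain a where a: "a \<in> V" using assms(3) by auto
  have "(\<Sum>i\<in>J. \<alpha> i *\<^sub>R (y i - a)) \<in> (\<lambda>x. x - a) ` V"
    using affine_diffs_subspace_subtract[OF assms(1) a] assms(3)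
    by (intro subspace_sum subspace_scale) auto
  moreover have "(\<Sum>i\<in>J. \<alpha> i *\<^sub>R (y i - a)) = (\<Sum>i\<in>J. \<alpha> i *\<^sub>R y i) - a"
    by (simp add: scaleR_right_diff_distrib sum_subtractf assms(2) flip: scaleR_left.sum)
  ultimately show ?thesis by auto
qed

text \<open>A net in relative coordinates, transported to a ball by its centre and radius. Radius 2
  leaves room for a point of the unit ball and a shift of length at most 1; the net point 0 stands
  for the centre, which serves tuples that repeat a ball.\<close>

lemma finite_net_cball:
  fixes \<epsilon> :: real
  assumes "\<epsilon> > 0"
  shows "\<exists>N :: 'a::euclidean_space set. finite N \<and> 0 \<in> N \<and>
           (\<forall>u\<in>cball 0 2. \<exists>y\<in>N. dist u y \<le> \<epsilon>)"
proof -
  obtain M :: "'a set" where M: "finite M" "cball 0 2 \<subseteq> (\<Union>x\<in>M. ball x \<epsilon>)"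
    using compact_cball[of "0::'a" 2] assms
    by (metis compact_eq_totally_bounded)
  show ?thesis
    by (rule exI[of _ "insert 0 M"]) (use M in \<open>force simp: dist_commute\<close>)
qed

text \<open>The ball \<open>l\<close> is the one with the largest \<open>\<bar>\<mu> i\<bar> * r i\<close>, where \<open>\<mu>\<close> is an affine relation between
  points of the flat in the balls. Then its point is an affine combination of the other points in
  which an error of relative size \<open>\<epsilon>\<close> in each ball costs little compared to \<open>r l\<close>, and a shift inside
  the ball \<open>a\<close> with the dominant term creates the room that absorbs these errors.\<close>

lemma hit_by_net_flat:
  fixes x :: "'i \<Rightarrow> 'a::euclidean_space" and r :: "'i \<Rightarrow> real"
  assumes I: "finite I" "card I = k + 2"
    and V: "is_flat k V" "\<And>i. i \<in> I \<Longrightarrow> hits V (cball (x i) (r i))"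
    and r: "\<And>i. i \<in> I \<Longrightarrow> r i > 0"
    and N: "\<And>u. u \<in> cball 0 2 \<Longrightarrow> \<exists>y\<in>N. dist u y \<le> 1 / (2 * (real k + 1))"
  shows "\<exists>l\<in>I. \<exists>n. (\<forall>i. n i \<in> N) \<and>
    (\<forall>V'. affine V' \<longrightarrow> (\<forall>i\<in>I - {l}. x i + r i *\<^sub>R n i \<in> V') \<longrightarrow> hits V' (cball (x l) (r l)))"
proof -
  have "\<exists>v. v \<in> V \<and> v \<in> cball (x i) (r i)" if "i \<in> I" for i
    using V(2)[OF that] by (auto simp: hits_def)
  then obtain v where v: "\<And>i. i \<in> I \<Longrightarrow> v i \<in> V" "\<And>i. i \<in> I \<Longrightarrow> dist (x i) (v i) \<le> r i"
    by (metis mem_cball)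
  obtain \<mu> where \<mu>: "sum \<mu> I = 0" "(\<Sum>i\<in>I. \<mu> i *\<^sub>R v i) = 0" "\<exists>i\<in>I. \<mu> i \<noteq> (0::real)"
    using affine_relation_of_points_in_flat[OF I V(1), of v] v(1) by auto
  have ex_max: "\<exists>l\<in>S. \<forall>i\<in>S. f i \<le> f l" if "finite S" "S \<noteq> {}" for S and f :: "'i \<Rightarrow> real"
  proof -
    have "Max (f ` S) \<in> f ` S" using that by simp
    then obtain l where "l \<in> S" "f l = Max (f ` S)" by auto
    then show ?thesis using that by (metis Max_ge finite_imageI imageI)
  qed
  have "I \<noteq> {}" using I by auto
  obtain l where l: "l \<in> I" "\<And>i. i \<in> I \<Longrightarrow> \<bar>\<mu> i\<bar> * r i \<le> \<bar>\<mu> l\<bar> * r l"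
    using ex_max[OF I(1) \<open>I \<noteq> {}\<close>, of "\<lambda>i. \<bar>\<mu> i\<bar> * r i"] by blast
  have \<mu>l: "\<mu> l \<noteq> 0"
  proof
    assume "\<mu> l = 0"
    obtain i where i: "i \<in> I" "\<mu> i \<noteq> 0" using \<mu> by auto
    have "\<bar>\<mu> i\<bar> * r i > 0" using i r by simp
    then show False using l(2)[OF i(1)] \<open>\<mu> l = 0\<close> by simp
  qed
  define J where "J = I - {l}"
  have J: "finite J" "card J = k + 1" using I l by (auto simp: J_def)
  \<comment> \<open>Solving the relation for \<open>v l\<close> makes it an affine combination of
    the other points. The choice of \<open>l\<close> becomes
    \<open>\<bar>\<alpha> i\<bar> * r i \<le> r l\<close>.\<close>
  define \<alpha> where "\<alpha> i = - \<mu> i / \<mu> l" for i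
  have sum\<alpha>: "sum \<alpha> J = 1"
  proof -
    have "\<mu> l + sum \<mu> J = 0" using \<mu>(1) l(1) I(1) by (simp add: J_def sum.remove)
    then have "sum \<mu> J = - \<mu> l" by linarith
    then show ?thesis using \<mu>l by (simp add: \<alpha>_def sum_negf flip: sum_divide_distrib)
  qed
  have vl: "(\<Sum>i\<in>J. \<alpha> i *\<^sub>R v i) = v l"
  proof -
    have "\<mu> l *\<^sub>R v l + (\<Sum>i\<in>J. \<mu> i *\<^sub>R v i) = 0" using \<mu>(2) l(1) I(1) by (simp add: J_def sum.remove)
    then have *: "(\<Sum>i\<in>J. \<mu> i *\<^sub>R v i) = - (\<mu> l *\<^sub>R v l)" by (simp add: eq_neg_iff_add_eq_0 add.commute)
    have "(\<Sum>i\<in>J. \<alpha> i *\<^sub>R v i) = (- 1 / \<mu> l) *\<^sub>R (\<Sum>i\<in>J. \<mu> i *\<^sub>R v i)"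
      by (simp add: \<alpha>_def scaleR_sum_right)
    then show ?thesis using * \<mu>l by simp
  qed
  have \<alpha>r: "\<bar>\<alpha> i\<bar> * r i \<le> r l" if "i \<in> J" for i
    using l(2)[of i] that \<mu>l by (simp add: \<alpha>_def J_def field_simps)
  have "J \<noteq> {}" using J by auto
  obtain a where a: "a \<in> J" "\<And>i. i \<in> J \<Longrightarrow> \<bar>\<alpha> i\<bar> * r i \<le> \<bar>\<alpha> a\<bar> * r a"
    using ex_max[OF J(1) \<open>J \<noteq> {}\<close>, of "\<lambda>i. \<bar>\<alpha> i\<bar> * r i"] by blast
  define m where "m = \<bar>\<alpha> a\<bar> * r a"
  have m: "m \<le> r l" "\<And>i. i \<in> J \<Longrightarrow> \<bar>\<alpha> i\<bar> * r i \<le> m"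
    unfolding m_def by (fact \<alpha>r[OF a(1)], fact a(2))
  have m0: "m \<ge> 0" using r[of a] a(1) by (simp add: m_def J_def)
  define e where "e = sgn (x l - v l)"
  have norm_e: "norm e \<le> 1" by (simp add: e_def norm_sgn)
  \<comment> \<open>Relative position of \<open>v i\<close> in its ball. At \<open>a\<close>, half a
    radius is added along the direction \<open>e\<close> from \<open>v l\<close> to the centre
    \<open>x l\<close>; the sign of \<open>\<alpha> a\<close> makes the combination move by exactly
    \<open>m / 2\<close> along \<open>e\<close>.\<close>
  define u where "u i = (1 / r i) *\<^sub>R (v i - x i) + (if i = a then (sgn (\<alpha> a) / 2) *\<^sub>R e else 0)" for i
  have u: "u i \<in> cball 0 2" if "i \<in> J" for i
  proof -
    have ri: "r i > 0" "dist (x i) (v i) \<le> r i" using that r v by (auto simp: J_def)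
    have "norm ((1 / r i) *\<^sub>R (v i - x i)) \<le> 1"
      using ri by (simp add: dist_norm norm_minus_commute)
    moreover have "norm ((sgn (\<alpha> a) / 2) *\<^sub>R e) \<le> 1"
      using norm_e by (auto simp: sgn_if)
    ultimately show ?thesis
      unfolding u_def mem_cball dist_0_norm
      by (intro order_trans[OF norm_triangle_ineq]) (auto split: if_splits)
  qed
  obtain n0 where n0: "\<And>i. i \<in> J \<Longrightarrow> n0 i \<in> N" "\<And>i. i \<in> J \<Longrightarrow> dist (u i) (n0 i) \<le> 1 / (2 * (real k + 1))"
    using bchoice[of J "\<lambda>i y. y \<in> N \<and> dist (u i) y \<le> 1 / (2 * (real k + 1))"] N[OF u] by blast
  define n where "n i = (if i \<in> J then n0 i else n0 a)" for i
  have n: "\<And>i. n i \<in> N" "\<And>i. i \<in> J \<Longrightarrow> dist (u i) (n i) \<le> 1 / (2 * (real k + 1))"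
    using n0 a(1) by (auto simp: n_def)
  define y where "y i = x i + r i *\<^sub>R n i" for i
  define z where "z i = x i + r i *\<^sub>R u i" for i
  have z: "z i = v i + (if i = a then (r a * sgn (\<alpha> a) / 2) *\<^sub>R e else 0)" if "i \<in> J" for i
    using that r[of i] by (auto simp: z_def u_def J_def scaleR_right_distrib)
  have zsum: "(\<Sum>i\<in>J. \<alpha> i *\<^sub>R z i) = v l + (m / 2) *\<^sub>R e"
  proof -
    have "(\<Sum>i\<in>J. \<alpha> i *\<^sub>R z i)
        = (\<Sum>i\<in>J. \<alpha> i *\<^sub>R v i + (if i = a then (\<alpha> a * (r a * sgn (\<alpha> a) / 2)) *\<^sub>R e else 0))"
      by (intro sum.cong) (auto simp: z scaleR_right_distrib)
    also have "\<dots> = v l + (\<alpha> a * (r a * sgn (\<alpha> a) / 2)) *\<^sub>R e"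
      using a(1) J(1) by (simp add: sum.distrib vl)
    also have "\<alpha> a * (r a * sgn (\<alpha> a) / 2) = m / 2"
      by (simp add: m_def abs_sgn mult.commute)
    finally show ?thesis .
  qed
  \<comment> \<open>The shift may overshoot the centre \<open>x l\<close>. Then the new distance is
    at most \<open>m / 2\<close>, which \<open>m \<le> r l\<close> keeps below
    \<open>r l - m / 2\<close>.\<close>
  have zdist: "dist (x l) (v l + (m / 2) *\<^sub>R e) \<le> r l - m / 2"
  proof (cases "x l = v l")
    case True
    then show ?thesis using m m0 by (simp add: e_def)
  next
    case False
    define D where "D = norm (x l - v l)"
    have D: "D > 0" "D \<le> r l" using False v(2)[OF l(1)] by (auto simp: D_def dist_norm)
    have e: "e = (1 / D) *\<^sub>R (x l - v l)" by (simp add: e_def sgn_div_norm D_def divide_inverse_commute)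
    have "x l - (v l + (m / 2) *\<^sub>R e) = (1 - m / 2 / D) *\<^sub>R (x l - v l)"
      unfolding e scaleR_left_diff_distrib by (simp add: diff_diff_eq)
    then have "dist (x l) (v l + (m / 2) *\<^sub>R e) = \<bar>1 - m / 2 / D\<bar> * D"
      by (simp add: dist_norm D_def)
    also have "\<dots> = \<bar>(1 - m / 2 / D) * D\<bar>" using D by (simp add: abs_mult)
    also have "(1 - m / 2 / D) * D = D - m / 2" using D by (simp add: field_simps)
    also have "\<bar>D - m / 2\<bar> \<le> r l - m / 2" using D m m0 by linarith
    finally show ?thesis .
  qed
  have yz: "norm ((\<Sum>i\<in>J. \<alpha> i *\<^sub>R z i) - (\<Sum>i\<in>J. \<alpha> i *\<^sub>R y i)) \<le> m / 2"
  proof -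
    have "norm ((\<Sum>i\<in>J. \<alpha> i *\<^sub>R z i) - (\<Sum>i\<in>J. \<alpha> i *\<^sub>R y i)) = norm (\<Sum>i\<in>J. (\<alpha> i * r i) *\<^sub>R (u i - n i))"
      by (simp add: z_def y_def algebra_simps flip: sum_subtractf)
    \<comment> \<open>Origin of the tolerance: \<open>k + 1\<close> errors of size at most
      \<open>m / (2 * (k + 1))\<close> use up the room \<open>m / 2\<close> gained by the
      shift.\<close>
    also have "\<dots> \<le> (\<Sum>i\<in>J. m * (1 / (2 * (real k + 1))))"
    proof (rule sum_norm_le)
      fix i assume i: "i \<in> J"
      then have "r i > 0" using r by (auto simp: J_def)
      then have "norm ((\<alpha> i * r i) *\<^sub>R (u i - n i)) = (\<bar>\<alpha> i\<bar> * r i) * dist (u i) (n i)"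
        by (simp add: dist_norm abs_mult)
      also have "\<dots> \<le> m * (1 / (2 * (real k + 1)))"
        using m(2)[OF i] n(2)[OF i] m0 by (intro mult_mono) auto
      finally show "norm ((\<alpha> i * r i) *\<^sub>R (u i - n i)) \<le> m * (1 / (2 * (real k + 1)))" .
    qed
    also have "\<dots> = m / 2" using J by (simp add: field_simps)
    finally show ?thesis .
  qed
  have q: "(\<Sum>i\<in>J. \<alpha> i *\<^sub>R y i) \<in> cball (x l) (r l)"
    using yz zdist norm_triangle_ineq4[of "x l - (v l + (m / 2) *\<^sub>R e)"
        "(\<Sum>i\<in>J. \<alpha> i *\<^sub>R y i) - (v l + (m / 2) *\<^sub>R e)"]
    by (simp add: zsum dist_norm norm_minus_commute)
  have "hits V' (cball (x l) (r l))" if "affine V'" "\<And>i. i \<in> J \<Longrightarrow> y i \<in> V'" for V'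
  proof -
    have "(\<Sum>i\<in>J. \<alpha> i *\<^sub>R y i) \<in> V'"
      using affine_sum_mem[OF that(1) sum\<alpha>] that(2) by auto
    then show ?thesis using q by (auto simp: hits_def)
  qed
  then have "\<forall>V'. affine V' \<longrightarrow> (\<forall>i\<in>I - {l}. x i + r i *\<^sub>R n i \<in> V') \<longrightarrow> hits V' (cball (x l) (r l))"
    by (simp only: J_def y_def) blast
  then show ?thesis using l(1) n(1) by blast
qed

section \<open>Nets of bounded size for set systems of bounded VC dimension\<close>

definition shatters :: "'a set set \<Rightarrow> 'a set \<Rightarrow> bool" where
  "shatters H S \<longleftrightarrow> (\<forall>A\<subseteq>S. \<exists>h\<in>H. h \<inter> S = A)"

text \<open>Pajor's form of the Sauer--Shelah lemma.\<close>

lemma card_le_card_shattered: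
  assumes "finite J" "H \<subseteq> Pow J"
  shows "card H \<le> card {S. S \<subseteq> J \<and> shatters H S}"
  using assms
proof (induction J arbitrary: H rule: finite_induct)
  case empty
  show ?case
  proof (cases "H = {}")
    case False
    then have "H = {{}}" using empty by auto
    then have "{S. S \<subseteq> {} \<and> shatters H S} = {{}}"
      by (auto simp: shatters_def)
    then have "card {S. S \<subseteq> {} \<and> shatters H S} = card {{} :: 'a set}" by (rule arg_cong)
    then show ?thesis using \<open>H = {{}}\<close> by simp
  qed simp
next
  case (insert a J)
  \<comment> \<open>Deleting \<open>a\<close> merges exactly the pairs \<open>h\<close>,
    \<open>insert a h\<close> that both lie in \<open>H\<close>. \<open>H1\<close> counts these
    pairs, and a set shattered by \<open>H1\<close> stays shattered by \<open>H\<close> after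
    \<open>a\<close> is added.\<close>
  define H0 where "H0 = (\<lambda>h. h - {a}) ` H"
  define H1 where "H1 = {h. h \<subseteq> J \<and> h \<in> H \<and> insert a h \<in> H}"
  have finH: "finite H" using insert by (meson finite_Pow_iff finite_insert finite_subset)
  have sub: "H0 \<subseteq> Pow J" "H1 \<subseteq> Pow J" using insert.prems by (auto simp: H0_def H1_def)
  have "card H = card H0 + card H1"
  proof -
    define A where "A = {h\<in>H. a \<notin> h}"
    define B where "B = (\<lambda>h. h - {a}) ` {h\<in>H. a \<in> h}"
    have "card {h\<in>H. a \<in> h} = card B"
      unfolding B_def by (intro card_image[symmetric] inj_onI) (metis (no_types, lifting) insert_Diff mem_Collect_eq)
    moreover have "card H = card A + card {h\<in>H. a \<in> h}"
      unfolding A_def using finH by (subst card_Un_disjoint[symmetric]) (auto intro: arg_cong[of _ _ card])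
    moreover have "H0 = A \<union> B"
    proof -
      have "H0 = (\<lambda>h. h - {a}) ` {h\<in>H. a \<notin> h} \<union> B" unfolding H0_def B_def by blast
      moreover have "(\<lambda>h. h - {a}) ` {h\<in>H. a \<notin> h} = A" by (force simp: A_def)
      ultimately show ?thesis by simp
    qed
    moreover have "H1 = A \<inter> B"
    proof (intro equalityI subsetI)
      fix h assume "h \<in> H1"
      then have "h \<in> H" "insert a h \<in> H" "a \<notin> h" using insert.hyps by (auto simp: H1_def)
      then show "h \<in> A \<inter> B"
        by (auto simp: A_def B_def intro!: image_eqI[of _ _ "insert a h"])
    next
      fix h assume h: "h \<in> A \<inter> B"
      then have "h \<in> H" "a \<notin> h" by (auto simp: A_def)
      moreover have "insert a h \<in> H" using h by (auto simp: B_def insert_absorb)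
      ultimately show "h \<in> H1" using insert.prems by (auto simp: H1_def)
    qed
    moreover have "finite A" "finite B" unfolding A_def B_def using finH by simp_all
    ultimately show ?thesis using card_Un_Int[of A B] by simp
  qed
  also have "\<dots> \<le> card {S. S \<subseteq> J \<and> shatters H0 S} + card {S. S \<subseteq> J \<and> shatters H1 S}"
    using insert.IH sub by (intro add_mono) auto
  also have "card {S. S \<subseteq> J \<and> shatters H1 S} = card (insert a ` {S. S \<subseteq> J \<and> shatters H1 S})"
    using insert.hyps by (intro card_image[symmetric] inj_onI) (auto simp: insert_ident)
  also have "card {S. S \<subseteq> J \<and> shatters H0 S} + card (insert a ` {S. S \<subseteq> J \<and> shatters H1 S})
      = card ({S. S \<subseteq> J \<and> shatters H0 S} \<union> insert a ` {S. S \<subseteq> J \<and> shatters H1 S})"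
    using insert.hyps by (intro card_Un_disjoint[symmetric]) auto
  also have "\<dots> \<le> card {S. S \<subseteq> insert a J \<and> shatters H S}"
  proof (intro card_mono subsetI)
    show "finite {S. S \<subseteq> insert a J \<and> shatters H S}" using insert.hyps by simp
  next
    fix S assume "S \<in> {S. S \<subseteq> J \<and> shatters H0 S} \<union> insert a ` {S. S \<subseteq> J \<and> shatters H1 S}"
    then consider (1) "S \<in> {S. S \<subseteq> J \<and> shatters H0 S}" | (2) "S \<in> insert a ` {S. S \<subseteq> J \<and> shatters H1 S}"
      by (rule UnE)
    then show "S \<in> {S. S \<subseteq> insert a J \<and> shatters H S}"
    proof cases
      case 1
      then have 1: "S \<subseteq> J" "shatters H0 S" by simp_all
      have "shatters H S"
        unfolding shatters_def
      proof (intro allI impI)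
        fix A assume "A \<subseteq> S"
        then obtain h0 where "h0 \<in> H0" "h0 \<inter> S = A"
          using 1(2) unfolding shatters_def by meson
        moreover then obtain h where "h \<in> H" "h0 = h - {a}" unfolding H0_def by blast
        moreover have "a \<notin> S" using 1 insert.hyps by auto
        ultimately show "\<exists>h\<in>H. h \<inter> S = A" by (intro bexI[of _ h]) auto
      qed
      then show ?thesis using 1 by auto
    next
      case 2
      then obtain S' where 2: "S = insert a S'" "S' \<subseteq> J" "shatters H1 S'" by (elim imageE) simp
      have "shatters H S"
        unfolding shatters_def
      proof (intro allI impI)
        fix A assume A: "A \<subseteq> S"
        then have "A - {a} \<subseteq> S'" using 2 by auto
        then obtain h where h: "h \<in> H1" "h \<inter> S' = A - {a}"
          using 2(3) unfolding shatters_def by meson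
        have hh: "h \<in> H" "insert a h \<in> H" "a \<notin> h" using h insert.hyps by (auto simp: H1_def)
        show "\<exists>h\<in>H. h \<inter> S = A"
        proof (cases "a \<in> A")
          case True
          then have "insert a h \<inter> S = A" using h 2 by auto
          then show ?thesis using hh by blast
        next
          case False
          then have "h \<inter> S = A" using h 2 hh by auto
          then show ?thesis using hh by blast
        qed
      qed
      then show ?thesis using 2 by auto
    qed
  qed
  finally show ?case .
qed

lemma card_small_subsets_le:
  assumes "finite J" "J \<noteq> {}"
  shows "card {S. S \<subseteq> J \<and> card S \<le> D} \<le> (D + 1) * card J ^ D"
proof -
  have fin: "finite {xs. set xs \<subseteq> J \<and> length xs \<le> D}"
    using assms(1) by (rule finite_lists_length_le)
  have "{S. S \<subseteq> J \<and> card S \<le> D} \<subseteq> set ` {xs. set xs \<subseteq> J \<and> length xs \<le> D}"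
  proof
    fix S assume "S \<in> {S. S \<subseteq> J \<and> card S \<le> D}"
    then have S: "S \<subseteq> J" "card S \<le> D" "finite S" using assms(1) finite_subset by auto
    then obtain xs where "set xs = S" "length xs = card S"
      using finite_distinct_list distinct_card by metis
    then show "S \<in> set ` {xs. set xs \<subseteq> J \<and> length xs \<le> D}" using S by (auto intro!: image_eqI[of _ _ xs])
  qed
  then have "card {S. S \<subseteq> J \<and> card S \<le> D} \<le> card {xs. set xs \<subseteq> J \<and> length xs \<le> D}"
    using fin by (meson card_image_le card_mono finite_imageI le_trans)
  also have "\<dots> = (\<Sum>i\<le>D. card J ^ i)" using assms(1) by (rule card_lists_length_le)
  also have "\<dots> \<le> (\<Sum>i\<le>D. card J ^ D)"
    using assms by (intro sum_mono power_increasing) (auto simp: Suc_le_eq card_gt_0_iff)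
  finally show ?thesis by simp
qed

text \<open>\<open>\<sigma>\<close> records the positions at which \<open>x\<close> and \<open>y\<close> are exchanged.\<close>

definition swap_fst :: "nat set \<Rightarrow> (nat \<Rightarrow> 'a) \<times> (nat \<Rightarrow> 'a) \<Rightarrow> nat \<Rightarrow> 'a" where
  "swap_fst \<sigma> z j = (if j \<in> \<sigma> then snd z j else fst z j)"

definition swap_pair :: "nat set \<Rightarrow> (nat \<Rightarrow> 'a) \<times> (nat \<Rightarrow> 'a) \<Rightarrow> (nat \<Rightarrow> 'a) \<times> (nat \<Rightarrow> 'a)" where
  "swap_pair \<sigma> z = (swap_fst \<sigma> z, swap_fst \<sigma> (snd z, fst z))"

lemma swap_pair_involution: "swap_pair \<sigma> (swap_pair \<sigma> z) = z"
  by (cases z) (auto simp: swap_pair_def swap_fst_def)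

text \<open>Once the traces of \<open>h\<close> on both samples are known, the positions in these traces determine \<open>\<sigma>\<close>
  there, which leaves \<open>2 ^ (s - m)\<close> choices.\<close>

lemma card_good_swaps_le:
  fixes A B :: "nat set"
  assumes "A \<subseteq> {..<s}" "B \<subseteq> {..<s}"
  shows "card {\<sigma>. \<sigma> \<subseteq> {..<s} \<and> A \<subseteq> \<sigma> \<and> \<sigma> \<inter> B = {} \<and> m \<le> card A + card B} * 2 ^ m \<le> 2 ^ s"
proof (cases "{\<sigma>. \<sigma> \<subseteq> {..<s} \<and> A \<subseteq> \<sigma> \<and> \<sigma> \<inter> B = {} \<and> m \<le> card A + card B} = {}")
  case True
  show ?thesis unfolding True by simp
next
  case False
  then have AB: "A \<inter> B = {}" and m: "m \<le> card A + card B" by auto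
  define R where "R = {..<s} - (A \<union> B)"
  have fin: "finite A" "finite B" using assms finite_subset by auto
  have cAB: "card (A \<union> B) = card A + card B" using AB fin by (simp add: card_Un_disjoint)
  have le: "card (A \<union> B) \<le> s" using assms card_mono[of "{..<s}" "A \<union> B"] by auto
  have R: "card R = s - (card A + card B)"
    unfolding R_def using assms fin cAB by (subst card_Diff_subset) auto
  have "{\<sigma>. \<sigma> \<subseteq> {..<s} \<and> A \<subseteq> \<sigma> \<and> \<sigma> \<inter> B = {} \<and> m \<le> card A + card B} \<subseteq> (\<lambda>T. A \<union> T) ` Pow R"
    (is "?L \<subseteq> _")
  proof
    fix \<sigma> assume "\<sigma> \<in> ?L"
    then have "\<sigma> = A \<union> (\<sigma> \<inter> R)" "\<sigma> \<inter> R \<in> Pow R" by (auto simp: R_def)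
    then show "\<sigma> \<in> (\<lambda>T. A \<union> T) ` Pow R" by blast
  qed
  moreover have finR: "finite R" by (simp add: R_def)
  ultimately have "card ?L \<le> card (Pow R)"
    using surj_card_le[of "Pow R" ?L "\<lambda>T. A \<union> T"] by simp
  also have "\<dots> = 2 ^ (s - (card A + card B))" using R finR by (simp add: card_Pow)
  finally have "card ?L * 2 ^ m \<le> 2 ^ (s - (card A + card B)) * 2 ^ (card A + card B)"
    using m by (intro mult_mono power_increasing) auto
  also have "\<dots> = 2 ^ s" using le cAB by (simp flip: power_add)
  finally show ?thesis .
qed


lemma sum_card_swap:
  assumes "finite A" "finite B"
  shows "(\<Sum>a\<in>A. card {b\<in>B. P a b}) = (\<Sum>b\<in>B. card {a\<in>A. P a b})"
proof -
  have "(\<Sum>a\<in>A. card {b\<in>B. P a b}) = (\<Sum>a\<in>A. \<Sum>b\<in>B. if P a b then 1 else 0)"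
    using assms by (simp flip: sum.inter_filter)
  also have "\<dots> = (\<Sum>b\<in>B. \<Sum>a\<in>A. if P a b then 1 else 0)" by (rule sum.swap)
  also have "\<dots> = (\<Sum>b\<in>B. card {a\<in>A. P a b})"
    using assms by (simp flip: sum.inter_filter)
  finally show ?thesis .
qed

text \<open>Counting pairs of a sample and a position shows that samples meet \<open>h\<close> in at
  least \<open>s / q = 2 * m\<close> positions on average. Samples with fewer than \<open>m\<close>
  such positions account for at most \<open>m\<close> of this average, and the others contribute at
  most \<open>s\<close> each, so their share is at least \<open>m / s = 1 / (2 * q)\<close>.\<close>

lemma many_second_samples:
  fixes P :: "'a set"
  assumes P: "finite P" "h \<subseteq> P" "card P \<le> q * card h"
    and s: "s = 2 * q * m" and m: "m > 0" and q: "q > 0"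
  shows "card P ^ s \<le> 2 * q * card {y\<in>PiE {..<s} (\<lambda>_. P). m \<le> card {j\<in>{..<s}. y j \<in> h}}"
proof -
  define T where "T = card P"
  define Y where "Y = PiE {..<s} (\<lambda>_. P)"
  define G where "G = {y\<in>Y. m \<le> card {j\<in>{..<s}. y j \<in> h}}"
  have finY: "finite Y" using P by (auto simp: Y_def intro: finite_PiE)
  have cardY: "card Y = T ^ s" by (simp add: Y_def card_PiE T_def)
  have s0: "s > 0" using s m q by simp
  have count: "card {y\<in>Y. y j \<in> h} = card h * T ^ (s - 1)" if j: "j < s" for j
  proof -
    have "{y\<in>Y. y j \<in> h} = PiE {..<s} (\<lambda>i. if i = j then h else P)"
    proof (intro equalityI subsetI)
      fix y assume "y \<in> {y\<in>Y. y j \<in> h}"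
      then show "y \<in> PiE {..<s} (\<lambda>i. if i = j then h else P)"
        by (auto simp: Y_def PiE_iff)
    next
      fix y assume y: "y \<in> PiE {..<s} (\<lambda>i. if i = j then h else P)"
      then have "y j \<in> h" using PiE_mem[OF y, of j] j by simp
      moreover have "y i \<in> P" if "i < s" for i
        using PiE_mem[OF y, of i] that P(2) by (cases "i = j") auto
      ultimately show "y \<in> {y\<in>Y. y j \<in> h}" using y by (simp add: Y_def PiE_iff)
    qed
    then have "card {y\<in>Y. y j \<in> h} = (\<Prod>i\<in>{..<s}. card (if i = j then h else P))"
      by (simp only: card_PiE finite_lessThan)
    also have "\<dots> = card (if j = j then h else P) * (\<Prod>i\<in>{..<s} - {j}. card (if i = j then h else P))"
      using j by (intro prod.remove) auto
    also have "(\<Prod>i\<in>{..<s} - {j}. card (if i = j then h else P)) = (\<Prod>i\<in>{..<s} - {j}. T)"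
      by (intro prod.cong) (auto simp: T_def)
    finally show ?thesis using j by simp
  qed
  have "(\<Sum>y\<in>Y. card {j\<in>{..<s}. y j \<in> h}) = (\<Sum>j\<in>{..<s}. card {y\<in>Y. y j \<in> h})"
    by (rule sum_card_swap[OF finY finite_lessThan])
  also have "\<dots> = (\<Sum>j\<in>{..<s}. card h * T ^ (s - 1))"
    by (intro sum.cong) (simp_all only: lessThan_iff count)
  finally have sum: "(\<Sum>y\<in>Y. card {j\<in>{..<s}. y j \<in> h}) = s * (card h * T ^ (s - 1))" by simp
  have Ts: "T ^ s = T * T ^ (s - 1)" using s0 by (cases s) auto
  have "2 * m * T ^ s * q = s * (T * T ^ (s - 1))"
    unfolding Ts using s by simp
  also have "\<dots> \<le> s * ((q * card h) * T ^ (s - 1))"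
    using P(3) by (intro mult_le_mono) (auto simp: T_def)
  also have "\<dots> = (\<Sum>y\<in>Y. card {j\<in>{..<s}. y j \<in> h}) * q" unfolding sum by simp
  finally have "2 * m * T ^ s \<le> (\<Sum>y\<in>Y. card {j\<in>{..<s}. y j \<in> h})"
    using q by (simp only: mult_le_cancel2)
  also have "\<dots> \<le> (\<Sum>y\<in>Y. (if y \<in> G then s else 0) + m)"
  proof (intro sum_mono)
    fix y assume "y \<in> Y"
    moreover have "card {j\<in>{..<s}. y j \<in> h} \<le> s"
      using card_mono[of "{..<s}" "{j\<in>{..<s}. y j \<in> h}"] by auto
    ultimately show "card {j\<in>{..<s}. y j \<in> h} \<le> (if y \<in> G then s else 0) + m"
      by (auto simp: G_def)
  qed
  also have "\<dots> = s * card G + m * T ^ s"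
  proof -
    have "(\<Sum>y\<in>Y. if y \<in> G then s else 0) = s * card {y\<in>Y. y \<in> G}"
      using finY by (simp flip: sum.inter_filter)
    moreover have "{y\<in>Y. y \<in> G} = G" by (auto simp: G_def)
    ultimately show ?thesis by (simp add: sum.distrib cardY)
  qed
  finally have "m * T ^ s \<le> s * card G" by simp
  then have "m * T ^ s \<le> m * (2 * q * card G)" by (simp only: s mult_ac)
  then have "T ^ s \<le> 2 * q * card G" using m by (simp only: mult_le_cancel1)
  then show ?thesis by (simp only: T_def G_def Y_def)
qed

text \<open>Shattering is applied to positions, since a sample may repeat a point. Two positions of
  the same point cannot be separated, so a shattered set of positions maps injectively to a
  shattered set of points.\<close>

lemma card_traces_le:
  fixes w :: "nat \<Rightarrow> 'a"
  assumes vc: "\<And>S. S \<subseteq> P \<Longrightarrow> shatters H S \<Longrightarrow> card S \<le> D"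
    and w: "\<And>j. j < N \<Longrightarrow> w j \<in> P" and N: "N > 0"
  shows "card ((\<lambda>h. {j\<in>{..<N}. w j \<in> h}) ` H) \<le> (D + 1) * N ^ D"
proof -
  define tr where "tr h = {j\<in>{..<N}. w j \<in> h}" for h
  have "card (tr ` H) \<le> card {A. A \<subseteq> {..<N} \<and> shatters (tr ` H) A}"
    by (rule card_le_card_shattered) (auto simp: tr_def)
  also have "\<dots> \<le> card {A. A \<subseteq> {..<N} \<and> card A \<le> D}"
  proof (intro card_mono subsetI)
    fix A assume "A \<in> {A. A \<subseteq> {..<N} \<and> shatters (tr ` H) A}"
    then have A: "A \<subseteq> {..<N}" "\<And>B. B \<subseteq> A \<Longrightarrow> \<exists>h\<in>H. tr h \<inter> A = B"
      unfolding shatters_def by blast+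
    have "inj_on w A"
    proof (intro inj_onI, rule ccontr)
      fix i j assume ij: "i \<in> A" "j \<in> A" "w i = w j" "i \<noteq> j"
      then obtain h where h: "tr h \<inter> A = {i}" using A(2)[of "{i}"] by blast
      have "i \<in> tr h \<inter> A" "j \<notin> tr h \<inter> A" using ij by (simp_all add: h)
      then show False using ij A(1) by (auto simp: tr_def)
    qed
    have "shatters H (w ` A)"
      unfolding shatters_def
    proof (intro allI impI)
      fix B assume B: "B \<subseteq> w ` A"
      obtain h where h: "h \<in> H" "tr h \<inter> A = {i\<in>A. w i \<in> B}"
        using A(2)[of "{i\<in>A. w i \<in> B}"] by blast
      have "w i \<in> h \<longleftrightarrow> w i \<in> B" if "i \<in> A" for i
      proof -
        have "w i \<in> h \<longleftrightarrow> i \<in> tr h \<inter> A" using that A(1) by (auto simp: tr_def)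
        then show ?thesis using that by (simp add: h(2))
      qed
      then have "h \<inter> w ` A = B" using B by blast
      then show "\<exists>h\<in>H. h \<inter> w ` A = B" using h(1) by blast
    qed
    then have "card (w ` A) \<le> D" using A(1) w by (intro vc) auto
    then show "A \<in> {A. A \<subseteq> {..<N} \<and> card A \<le> D}"
      using A(1) \<open>inj_on w A\<close> by (simp add: card_image)
  qed simp
  also have "\<dots> \<le> (D + 1) * card {..<N} ^ D"
    using N by (intro card_small_subsets_le) auto
  finally show ?thesis by (simp add: tr_def)
qed

text \<open>Each exchange is charged to the trace of a witness \<open>h\<close> on the concatenation
  \<open>w\<close> of both samples. Positions with \<open>x j\<close> in \<open>h\<close> must be
  exchanged, those with \<open>y j\<close> in \<open>h\<close> must not, so one trace admits at most
  \<open>2 ^ (s - m)\<close> exchanges. The union bound runs over traces and not over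
  \<open>H\<close>, which may be large.\<close>

lemma card_swaps_le:
  fixes P :: "'a set"
  assumes vc: "\<And>S. S \<subseteq> P \<Longrightarrow> shatters H S \<Longrightarrow> card S \<le> D"
    and x: "\<And>j. j < s \<Longrightarrow> x j \<in> P" and y: "\<And>j. j < s \<Longrightarrow> y j \<in> P" and s: "s > 0"
  shows "card {\<sigma>\<in>Pow {..<s}. \<exists>h\<in>H. (\<forall>j<s. swap_fst \<sigma> (x, y) j \<notin> h) \<and>
      m \<le> card {j\<in>{..<s}. swap_fst \<sigma> (y, x) j \<in> h}} * 2 ^ m \<le> (D + 1) * (2 * s) ^ D * 2 ^ s"
    (is "card ?L * _ \<le> _")
proof -
  define w where "w j = (if j < s then x j else y (j - s))" for j
  have wP: "w j \<in> P" if "j < 2 * s" for j using that x y by (auto simp: w_def)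
  define tr where "tr h = {j\<in>{..<2 * s}. w j \<in> h}" for h
  define fst_pos where "fst_pos t = {j\<in>{..<s}. j \<in> t}" for t :: "nat set"
  define snd_pos where "snd_pos t = {j\<in>{..<s}. j + s \<in> t}" for t :: "nat set"
  define S where "S t = {\<sigma>. \<sigma> \<subseteq> {..<s} \<and> fst_pos t \<subseteq> \<sigma> \<and> \<sigma> \<inter> snd_pos t = {} \<and>
      m \<le> card (fst_pos t) + card (snd_pos t)}" for t
  have fin: "finite (tr ` H)" by (rule finite_subset[of _ "Pow {..<2 * s}"]) (auto simp: tr_def)
  have traces: "card (tr ` H) \<le> (D + 1) * (2 * s) ^ D"
    unfolding tr_def using s by (intro card_traces_le[OF vc wP]) auto
  have "?L \<subseteq> (\<Union>t\<in>tr ` H. S t)"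
  proof
    fix \<sigma> assume "\<sigma> \<in> ?L"
    then obtain h where \<sigma>: "\<sigma> \<subseteq> {..<s}" and h: "h \<in> H" "\<And>j. j < s \<Longrightarrow> swap_fst \<sigma> (x, y) j \<notin> h"
      "m \<le> card {j\<in>{..<s}. swap_fst \<sigma> (y, x) j \<in> h}"
      by blast
    have pos: "fst_pos (tr h) = {j\<in>{..<s}. x j \<in> h}" "snd_pos (tr h) = {j\<in>{..<s}. y j \<in> h}"
      by (auto simp: fst_pos_def snd_pos_def tr_def w_def)
    have "j \<in> \<sigma>" if "j < s" "x j \<in> h" for j
      using h(2)[OF that(1)] that(2) by (auto simp: swap_fst_def split: if_splits)
    then have "fst_pos (tr h) \<subseteq> \<sigma>" by (auto simp: pos)
    moreover have "j \<notin> \<sigma>" if "j < s" "y j \<in> h" for j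
      using h(2)[OF that(1)] that(2) by (auto simp: swap_fst_def split: if_splits)
    then have "\<sigma> \<inter> snd_pos (tr h) = {}" by (auto simp: pos)
    moreover have "{j\<in>{..<s}. swap_fst \<sigma> (y, x) j \<in> h} \<subseteq> fst_pos (tr h) \<union> snd_pos (tr h)"
      by (auto simp: pos swap_fst_def split: if_splits)
    then have "card {j\<in>{..<s}. swap_fst \<sigma> (y, x) j \<in> h} \<le> card (fst_pos (tr h) \<union> snd_pos (tr h))"
      by (intro card_mono) (auto simp: pos)
    then have "m \<le> card (fst_pos (tr h)) + card (snd_pos (tr h))"
      using h(3) card_Un_le[of "fst_pos (tr h)" "snd_pos (tr h)"] by linarith
    ultimately have "\<sigma> \<in> S (tr h)" using \<sigma> by (simp add: S_def)
    then show "\<sigma> \<in> (\<Union>t\<in>tr ` H. S t)" using h(1) by blast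
  qed
  moreover have "finite (S t)" for t
    by (rule finite_subset[of _ "Pow {..<s}"]) (auto simp: S_def)
  ultimately have "card ?L \<le> card (\<Union>t\<in>tr ` H. S t)"
    using fin by (intro card_mono) blast+
  also have "\<dots> \<le> (\<Sum>t\<in>tr ` H. card (S t))" using fin by (rule card_UN_le)
  finally have "card ?L * 2 ^ m \<le> (\<Sum>t\<in>tr ` H. card (S t)) * 2 ^ m" by (rule mult_le_mono1)
  also have "\<dots> = (\<Sum>t\<in>tr ` H. card (S t) * 2 ^ m)" by (rule sum_distrib_right)
  also have "\<dots> \<le> (\<Sum>t\<in>tr ` H. 2 ^ s)"
    unfolding S_def by (intro sum_mono card_good_swaps_le) (auto simp: fst_pos_def snd_pos_def)
  also have "\<dots> = card (tr ` H) * 2 ^ s" by simp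
  also have "\<dots> \<le> (D + 1) * (2 * s) ^ D * 2 ^ s" using traces by (rule mult_le_mono1)
  finally show ?thesis .
qed

text \<open>Vapnik and Chervonenkis' double sampling. A Markov estimate shows that a random
  second sample \<open>y\<close> meets a fixed set \<open>h\<close> at least \<open>m\<close> times with probability at least \<open>1 / (2 * q)\<close>; for a
  fixed pair of samples, exchanging random positions makes \<open>h\<close> miss the first sample and meet the second
  one \<open>m\<close> times with probability at most \<open>1 / 2 ^ m\<close>, for each of polynomially many traces.\<close>

lemma net_of_samples:
  fixes P :: "'a set"
  assumes P: "finite P" "P \<noteq> {}"
    and H: "\<And>h. h \<in> H \<Longrightarrow> h \<subseteq> P" "\<And>h. h \<in> H \<Longrightarrow> card P \<le> q * card h"
    and vc: "\<And>S. S \<subseteq> P \<Longrightarrow> shatters H S \<Longrightarrow> card S \<le> D"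
    and s: "s = 2 * q * m" and m: "m > 0" and q: "q > 0"
    and large: "2 * q * ((D + 1) * (2 * s) ^ D) < 2 ^ m"
  shows "\<exists>X\<subseteq>P. card X \<le> s \<and> (\<forall>h\<in>H. h \<inter> X \<noteq> {})"
proof (rule ccontr)
  assume contra: "\<not> ?thesis"
  define T where "T = card P"
  have T: "T > 0" using P by (simp add: T_def card_gt_0_iff)
  have s0: "s > 0" using s m q by simp
  define Y where "Y = PiE {..<s} (\<lambda>_. P)"
  have finY: "finite Y" using P by (auto simp: Y_def intro: finite_PiE)
  have cardY: "card Y = T ^ s" by (simp add: Y_def card_PiE T_def)
  have ex: "\<exists>h. h \<in> H \<and> (\<forall>j<s. x j \<notin> h)" if "x \<in> Y" for x
  proof (rule ccontr)
    assume *: "\<not> ?thesis"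
    have "x ` {..<s} \<subseteq> P" using that by (auto simp: Y_def)
    moreover have "card (x ` {..<s}) \<le> s" using card_image_le[of "{..<s}" x] by simp
    moreover have "\<forall>h\<in>H. h \<inter> x ` {..<s} \<noteq> {}" using * by blast
    ultimately show False using contra by blast
  qed
  define hh where "hh x = (SOME h. h \<in> H \<and> (\<forall>j<s. x j \<notin> h))" for x
  have hh: "hh x \<in> H" "\<forall>j<s. x j \<notin> hh x" if "x \<in> Y" for x
    using someI_ex[OF ex[OF that]] by (simp_all add: hh_def)
  define G where "G x = {y\<in>Y. m \<le> card {j\<in>{..<s}. y j \<in> hh x}}" for x
  have G: "T ^ s \<le> 2 * q * card (G x)" if "x \<in> Y" for x
    unfolding T_def G_def Y_def
    by (rule many_second_samples[OF P(1) H(1)[OF hh(1)[OF that]] H(2)[OF hh(1)[OF that]] s m q])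
  \<comment> \<open>The bad pairs: some \<open>h\<close> is missed by the first sample and met often
    by the second. If no net existed, every first sample would miss some \<open>hh x\<close>, and
    \<open>R\<close> would fill at least a fraction \<open>1 / (2 * q)\<close> of all pairs.\<close>
  define R where "R = {z\<in>Y \<times> Y. \<exists>h\<in>H. (\<forall>j<s. fst z j \<notin> h) \<and> m \<le> card {j\<in>{..<s}. snd z j \<in> h}}"
  have finR: "finite R" using finY by (simp add: R_def)
  have cardR: "T ^ s * T ^ s \<le> 2 * q * card R"
  proof -
    have "T ^ s * T ^ s = (\<Sum>x\<in>Y. T ^ s)" by (simp add: cardY)
    also have "\<dots> \<le> (\<Sum>x\<in>Y. 2 * q * card (G x))" by (intro sum_mono G)
    also have "\<dots> = 2 * q * (\<Sum>x\<in>Y. card (G x))" by (rule sum_distrib_left[symmetric])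
    also have "(\<Sum>x\<in>Y. card (G x)) = card (SIGMA x:Y. G x)"
      using finY by (subst card_SigmaI) (auto simp: G_def)
    also have "(SIGMA x:Y. G x) \<subseteq> R"
    proof
      fix z assume "z \<in> (SIGMA x:Y. G x)"
      then obtain x y where z: "z = (x, y)" "x \<in> Y" "y \<in> G x" by (rule SigmaE)
      then have "y \<in> Y" "m \<le> card {j\<in>{..<s}. y j \<in> hh x}" by (simp_all add: G_def)
      then show "z \<in> R" using z hh[of x] unfolding R_def by auto
    qed
    then have "card (SIGMA x:Y. G x) \<le> card R" using finR by (rule card_mono[rotated])
    finally show ?thesis by simp
  qed
  have swapY: "swap_pair \<sigma> z \<in> Y \<times> Y" if "z \<in> Y \<times> Y" for \<sigma> z
  proof -
    have "swap_fst \<sigma> (x, y) \<in> Y" if "x \<in> Y" "y \<in> Y" for x y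
      using that by (simp add: swap_fst_def Y_def PiE_iff extensional_def)
    then show ?thesis using that unfolding swap_pair_def by (cases z) simp
  qed
  \<comment> \<open>Each exchange permutes the pairs of samples, so averaging over exchanges does
    not change the number of bad pairs. This lets the bound for a fixed pair limit
    \<open>card R\<close>.\<close>
  have "card {z\<in>Y \<times> Y. swap_pair \<sigma> z \<in> R} = card R" for \<sigma>
  proof -
    have "{z\<in>Y \<times> Y. swap_pair \<sigma> z \<in> R} = swap_pair \<sigma> ` R"
    proof (intro equalityI subsetI)
      fix z assume "z \<in> {z\<in>Y \<times> Y. swap_pair \<sigma> z \<in> R}"
      then show "z \<in> swap_pair \<sigma> ` R"
        by (intro image_eqI[of _ _ "swap_pair \<sigma> z"]) (simp_all add: swap_pair_involution)
    next
      fix z assume "z \<in> swap_pair \<sigma> ` R"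
      then obtain z' where "z' \<in> R" "z = swap_pair \<sigma> z'" by auto
      moreover have "z' \<in> Y \<times> Y" using \<open>z' \<in> R\<close> unfolding R_def by blast
      ultimately show "z \<in> {z\<in>Y \<times> Y. swap_pair \<sigma> z \<in> R}"
        using swapY[of z' \<sigma>] by (simp add: swap_pair_involution)
    qed
    moreover have "inj_on (swap_pair \<sigma>) R"
      by (rule inj_on_inverseI[of _ "swap_pair \<sigma>"]) (rule swap_pair_involution)
    ultimately show ?thesis by (simp add: card_image)
  qed
  then have total: "2 ^ s * card R = (\<Sum>z\<in>Y \<times> Y. card {\<sigma>\<in>Pow {..<s}. swap_pair \<sigma> z \<in> R})"
    using finY sum_card_swap[of "Pow {..<s}" "Y \<times> Y" "\<lambda>\<sigma> z. swap_pair \<sigma> z \<in> R"] by (simp add: card_Pow)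
  have fibre: "card {\<sigma>\<in>Pow {..<s}. swap_pair \<sigma> z \<in> R} * 2 ^ m \<le> (D + 1) * (2 * s) ^ D * 2 ^ s"
    if z: "z \<in> Y \<times> Y" for z
  proof -
    obtain x y where xy: "z = (x, y)" by (cases z)
    have "{\<sigma>\<in>Pow {..<s}. swap_pair \<sigma> z \<in> R} = {\<sigma>\<in>Pow {..<s}. \<exists>h\<in>H. (\<forall>j<s. swap_fst \<sigma> (x, y) j \<notin> h) \<and>
        m \<le> card {j\<in>{..<s}. swap_fst \<sigma> (y, x) j \<in> h}}"
      using swapY[OF z] by (simp add: R_def swap_pair_def xy)
    moreover have "x j \<in> P" "y j \<in> P" if "j < s" for j
      using z that by (auto simp: xy Y_def PiE_iff)
    ultimately show ?thesis using card_swaps_le[OF vc _ _ s0, where x = x and y = y and m = m] by simp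
  qed
  have "2 ^ s * card R * 2 ^ m \<le> (\<Sum>z\<in>Y \<times> Y. (D + 1) * (2 * s) ^ D * 2 ^ s)"
    unfolding total sum_distrib_right by (intro sum_mono fibre)
  also have "\<dots> = T ^ s * T ^ s * ((D + 1) * (2 * s) ^ D * 2 ^ s)"
    using cardY by (simp add: card_cartesian_product)
  also have "\<dots> \<le> 2 * q * card R * ((D + 1) * (2 * s) ^ D * 2 ^ s)"
    using cardR by (rule mult_le_mono1)
  finally have "(2 ^ s * card R) * 2 ^ m \<le> (2 ^ s * card R) * (2 * q * ((D + 1) * (2 * s) ^ D))"
    by (simp only: mult_ac)
  moreover have "card R > 0"
  proof (rule ccontr)
    assume "\<not> card R > 0"
    then show False using cardR T by simp
  qed
  ultimately have "2 ^ m \<le> 2 * q * ((D + 1) * (2 * s) ^ D)"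
    by (simp only: mult_le_cancel1) simp
  then show False using large by linarith
qed

text \<open>With \<open>s = 2 * q * m\<close>, the number of traces is polynomial in
  \<open>m\<close> of degree \<open>D\<close>, so \<open>2 ^ m\<close> exceeds it for large
  \<open>m\<close>. This choice of \<open>m\<close> involves only \<open>q\<close> and
  \<open>D\<close>.\<close>

lemma bounded_net:
  fixes q D :: nat
  assumes "q > 0"
  shows "\<exists>s. \<forall>(P :: 'a set) H. finite P \<longrightarrow> P \<noteq> {} \<longrightarrow>
    (\<forall>h\<in>H. h \<subseteq> P \<and> card P \<le> q * card h) \<longrightarrow>
    (\<forall>S\<subseteq>P. shatters H S \<longrightarrow> card S \<le> D) \<longrightarrow>
    (\<exists>X\<subseteq>P. card X \<le> s \<and> (\<forall>h\<in>H. h \<inter> X \<noteq> {}))"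
proof -
  have "eventually (\<lambda>m. 2 * real q * ((real D + 1) * (2 * (2 * real q * real m)) ^ D) < 2 ^ m) sequentially"
    using assms by real_asymp
  then obtain m0 where m0: "\<And>m. m \<ge> m0 \<Longrightarrow>
      2 * real q * ((real D + 1) * (2 * (2 * real q * real m)) ^ D) < 2 ^ m"
    by (auto simp: eventually_at_top_linorder)
  obtain m where m: "m \<ge> m0" "m > 0" by (meson max.cobounded1 max.cobounded2 less_le_trans zero_less_one)
  have "real (2 * q * ((D + 1) * (2 * (2 * q * m)) ^ D)) < real (2 ^ m)"
    using m0[OF m(1)] by (simp only: of_nat_mult of_nat_add of_nat_power of_nat_numeral of_nat_1)
  then have "2 * q * ((D + 1) * (2 * (2 * q * m)) ^ D) < 2 ^ m"
    unfolding of_nat_less_iff .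
  then show ?thesis
    using assms m(2) by (intro exI[of _ "2 * q * m"] allI impI net_of_samples[where m = m and D = D]) auto
qed

section \<open>From fractional to frequent hitting\<close>

text \<open>\<open>M\<close> is a set of recipes; \<open>f m t\<close> is built from
  \<open>t\<close> without its entry \<open>pos m\<close>, as \<open>indep\<close> says. If every
  \<open>f m t\<close> were light, then summing over the entry \<open>pos m\<close> alone would show
  that recipe \<open>m\<close> hits its target on less than a share \<open>1 / card M\<close> of the
  tuple weight. The recipes together would then not account for all tuples, contrary to
  \<open>ex\<close>.\<close>

lemma heavy_set_of_tuples:
  fixes w :: "'b \<Rightarrow> real" and f :: "'m \<Rightarrow> (nat \<Rightarrow> 'b) \<Rightarrow> 'c" and pos :: "'m \<Rightarrow> nat"
  assumes F: "finite F" "F \<noteq> {}" and w: "\<And>b. b \<in> F \<Longrightarrow> w b > 0" and M: "finite M"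
    and pos: "\<And>m. m \<in> M \<Longrightarrow> pos m < p"
    and indep: "\<And>m t b. m \<in> M \<Longrightarrow> f m (t(pos m := b)) = f m t"
    and ex: "\<And>t. t \<in> PiE {..<p} (\<lambda>_. F) \<Longrightarrow> \<exists>m\<in>M. hit (f m t) (t (pos m))"
  shows "\<exists>m\<in>M. \<exists>t\<in>PiE {..<p} (\<lambda>_. F). sum w F \<le> real (card M) * sum w {b\<in>F. hit (f m t) b}"
proof (rule ccontr)
  assume contra: "\<not> ?thesis"
  define X where "X = PiE {..<p} (\<lambda>_. F)"
  define W where "W = sum w F"
  define \<omega> where "\<omega> t = (\<Prod>i<p. w (t i))" for t
  define c where "c = real (card M)"
  have finX: "finite X" using F by (auto simp: X_def intro: finite_PiE)
  have "X \<noteq> {}" using F by (simp add: X_def PiE_eq_empty_iff)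
  then have "M \<noteq> {}" using ex by (auto simp: X_def)
  then have c: "c > 0" using M by (simp add: c_def card_gt_0_iff)
  have small: "c * sum w {b\<in>F. hit (f m t) b} < W" if "m \<in> M" "t \<in> X" for m t
    using contra that by (auto simp: X_def W_def c_def not_le)
  have total: "(\<Sum>t\<in>X. \<omega> t) = W ^ p"
    using prod_sum_PiE[of "{..<p}" "\<lambda>_. F" "\<lambda>_. w"] F by (simp add: X_def \<omega>_def W_def)
  have part: "c * (\<Sum>t\<in>{t\<in>X. hit (f m t) (t (pos m))}. \<omega> t) < W ^ p" if m: "m \<in> M" for m
  proof -
    define l where "l = pos m"
    define J where "J = {..<p} - {l}"
    define X' where "X' = PiE J (\<lambda>_. F)"
    define \<omega>' where "\<omega>' g = (\<Prod>i\<in>J. w (g i))" for g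
    have lp: "l < p" using pos m by (simp add: l_def)
    then have J: "{..<p} = insert l J" "l \<notin> J" "finite J" "card J = p - 1" by (auto simp: J_def)
    have finX': "finite X'" using F J by (auto simp: X'_def intro: finite_PiE)
    have "X' \<noteq> {}" using F J by (simp add: X'_def PiE_eq_empty_iff)
    have upd: "g(l := b) \<in> X" if "g \<in> X'" "b \<in> F" for g b
      using that PiE_fun_upd[of b "\<lambda>_. F" l g J] by (simp add: X_def X'_def J(1))
    have \<omega>: "\<omega> (g(l := b)) = w b * \<omega>' g" for g b
    proof -
      have "(\<Prod>i\<in>J. w ((g(l := b)) i)) = \<omega>' g"
        unfolding \<omega>'_def using J(2) by (intro prod.cong) auto
      then show ?thesis unfolding \<omega>_def J(1) using J(2,3) by simp
    qed
    have \<omega>'_pos: "\<omega>' g > 0" if "g \<in> X'" for g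
      unfolding \<omega>'_def using that w by (intro prod_pos) (auto simp: X'_def PiE_iff)
    \<comment> \<open>Fubini in the entry \<open>l\<close>: a tuple splits into its value at
      \<open>l\<close> and the remaining function, whose value at \<open>l\<close> is reset to
      \<open>undefined\<close> so that it is extensional on \<open>J\<close>.\<close>
    have split: "(\<Sum>t\<in>{t\<in>X. hit (f m t) (t l)}. \<omega> t)
        = (\<Sum>g\<in>X'. \<Sum>b\<in>{b\<in>F. hit (f m g) b}. w b * \<omega>' g)"
    proof -
      have "(\<Sum>t\<in>{t\<in>X. hit (f m t) (t l)}. \<omega> t)
        = (\<Sum>(g, b)\<in>(SIGMA g:X'. {b\<in>F. hit (f m g) b}). w b * \<omega>' g)"
      proof (rule sum.reindex_bij_witness[of _ "\<lambda>(g, b). g(l := b)" "\<lambda>t. (t(l := undefined), t l)"])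
        fix t assume t: "t \<in> {t\<in>X. hit (f m t) (t l)}"
        show "(\<lambda>(g, b). g(l := b)) (t(l := undefined), t l) = t" by simp
        have "t(l := undefined) \<in> X'"
          using t fun_upd_in_PiE[OF J(2), of t "\<lambda>_. F"] by (simp add: X_def X'_def J(1))
        moreover have "t l \<in> F" using t lp by (auto simp: X_def)
        moreover have "hit (f m (t(l := undefined))) (t l)"
          using t indep[OF m] by (simp add: l_def)
        ultimately show "(t(l := undefined), t l) \<in> (SIGMA g:X'. {b\<in>F. hit (f m g) b})" by simp
        show "(case (t(l := undefined), t l) of (g, b) \<Rightarrow> w b * \<omega>' g) = \<omega> t"
          using \<omega>[of "t(l := undefined)" "t l"] by simp
      next
        fix gb assume gb: "gb \<in> (SIGMA g:X'. {b\<in>F. hit (f m g) b})"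
        then obtain g b where eq: "gb = (g, b)" and g: "g \<in> X'" "b \<in> F" "hit (f m g) b" by auto
        have "g l = undefined" using g(1) J(2) by (auto simp: X'_def)
        then have "g(l := undefined) = g" by (metis fun_upd_triv)
        then show "(((case gb of (g, b) \<Rightarrow> g(l := b))(l := undefined)), (case gb of (g, b) \<Rightarrow> g(l := b)) l) = gb"
          by (simp add: eq)
        show "(case gb of (g, b) \<Rightarrow> g(l := b)) \<in> {t\<in>X. hit (f m t) (t l)}"
          using upd[OF g(1,2)] g(3) indep[OF m] by (simp add: eq l_def)
      qed
      also have "\<dots> = (\<Sum>g\<in>X'. \<Sum>b\<in>{b\<in>F. hit (f m g) b}. w b * \<omega>' g)"
        using finX' F(1) by (subst sum.Sigma) auto
      finally show ?thesis .
    qed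
    have "c * (\<Sum>t\<in>{t\<in>X. hit (f m t) (t l)}. \<omega> t) = (\<Sum>g\<in>X'. c * sum w {b\<in>F. hit (f m g) b} * \<omega>' g)"
      unfolding split by (simp add: sum_distrib_left sum_distrib_right mult.assoc)
    also have "\<dots> < (\<Sum>g\<in>X'. W * \<omega>' g)"
    proof (rule sum_strict_mono[OF finX' \<open>X' \<noteq> {}\<close>])
      fix g assume g: "g \<in> X'"
      obtain b where "b \<in> F" using F by auto
      then have "c * sum w {b\<in>F. hit (f m g) b} < W"
        using small[OF m upd[OF g]] indep[OF m] by (simp add: l_def)
      then show "c * sum w {b\<in>F. hit (f m g) b} * \<omega>' g < W * \<omega>' g"
        using \<omega>'_pos[OF g] by simp
    qed
    also have "\<dots> = W * W ^ (p - 1)"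
      using prod_sum_PiE[of J "\<lambda>_. F" "\<lambda>_. w"] F J by (simp add: X'_def \<omega>'_def W_def flip: sum_distrib_left)
    also have "\<dots> = W ^ p" using lp by (cases p) auto
    finally show ?thesis by (simp add: l_def)
  qed
  have \<omega>_nonneg: "\<omega> t \<ge> 0" if "t \<in> X" for t
    unfolding \<omega>_def using that w by (intro prod_nonneg) (auto simp: X_def PiE_iff less_imp_le)
  have "W ^ p \<le> (\<Sum>t\<in>X. \<Sum>m\<in>M. if hit (f m t) (t (pos m)) then \<omega> t else 0)"
    unfolding total[symmetric]
  proof (rule sum_mono)
    fix t assume t: "t \<in> X"
    then obtain m where m: "m \<in> M" "hit (f m t) (t (pos m))" using ex by (auto simp: X_def)
    then show "\<omega> t \<le> (\<Sum>m\<in>M. if hit (f m t) (t (pos m)) then \<omega> t else 0)"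
      using member_le_sum[of m M "\<lambda>m. if hit (f m t) (t (pos m)) then \<omega> t else 0"] M \<omega>_nonneg[OF t]
      by simp
  qed
  also have "\<dots> = (\<Sum>m\<in>M. \<Sum>t\<in>{t\<in>X. hit (f m t) (t (pos m))}. \<omega> t)"
    using finX by (subst sum.swap) (simp flip: sum.inter_filter)
  finally have "c * W ^ p \<le> c * (\<Sum>m\<in>M. \<Sum>t\<in>{t\<in>X. hit (f m t) (t (pos m))}. \<omega> t)"
    using c by simp
  also have "\<dots> = (\<Sum>m\<in>M. c * (\<Sum>t\<in>{t\<in>X. hit (f m t) (t (pos m))}. \<omega> t))"
    by (rule sum_distrib_left)
  also have "\<dots> < (\<Sum>m\<in>M. W ^ p)"
    using M \<open>M \<noteq> {}\<close> part by (rule sum_strict_mono)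
  also have "\<dots> = c * W ^ p" by (simp add: c_def)
  finally show False by simp
qed

text \<open>Multiplicative weights: the weight of each set that is hit is halved, so the total weight decays
  geometrically, which forces every set to be hit a positive fraction of the time.\<close>

lemma frequent_hits_of_fractional_hits:
  fixes K :: real
  assumes K: "K \<ge> 1"
  shows "\<exists>q>0. \<forall>(F :: 'b set) (\<V> :: 'c set) hit. finite F \<longrightarrow> F \<noteq> {} \<longrightarrow>
    (\<forall>w. (\<forall>b\<in>F. w b > 0) \<longrightarrow> (\<exists>V\<in>\<V>. sum w F \<le> K * sum w {b\<in>F. hit V b})) \<longrightarrow>
    (\<exists>T>0. \<exists>V. (\<forall>j<T. V j \<in> \<V>) \<and> (\<forall>b\<in>F. T \<le> q * card {j\<in>{..<T}. hit (V j) b}))"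
proof -
  \<comment> \<open>At least a fraction \<open>1 / K\<close> of the weight is halved in each round,
    which multiplies the total by at most \<open>\<rho>\<close>.\<close>
  define \<rho> where "\<rho> = 1 - 1 / (2 * K)"
  have \<rho>: "0 \<le> \<rho>" "\<rho> < 1" using K by (auto simp: \<rho>_def field_simps)
  \<comment> \<open>After \<open>q0 * n\<close> rounds the total is at most
    \<open>n * (1 / 4) ^ n \<le> (1 / 2) ^ n\<close>. A member hit fewer than \<open>n\<close> times
    would alone weigh more, so each is hit in a fraction \<open>1 / q0\<close> of the
    rounds.\<close>
  obtain q0 where q0: "\<rho> ^ q0 < 1 / 4" using real_arch_pow_inv[of "1 / 4" \<rho>] \<rho> by auto
  have "q0 > 0" using q0 by (cases q0) auto
  show ?thesis
  proof (rule exI[of _ q0], intro conjI allI impI)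
    show "q0 > 0" by fact
    fix F :: "'b set" and \<V> :: "'c set" and hit
    assume F: "finite F" "F \<noteq> {}"
      and frac: "\<forall>w. (\<forall>b\<in>F. w b > 0) \<longrightarrow> (\<exists>V\<in>\<V>. sum w F \<le> K * sum w {b\<in>F. hit V b})"
    define n where "n = card F"
    have n: "n > 0" using F by (simp add: n_def card_gt_0_iff)
    have "\<exists>V. (\<forall>j<T. V j \<in> \<V>) \<and>
      (\<Sum>b\<in>F. (1 / 2) ^ card {j\<in>{..<T}. hit (V j) b}) \<le> real n * \<rho> ^ T" for T
    proof (induction T)
      case 0
      show ?case by (simp add: n_def)
    next
      case (Suc T)
      then obtain V where V: "\<forall>j<T. V j \<in> \<V>"
        "(\<Sum>b\<in>F. (1 / 2) ^ card {j\<in>{..<T}. hit (V j) b}) \<le> real n * \<rho> ^ T" by blast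
      define w :: "'b \<Rightarrow> real" where "w b = (1 / 2) ^ card {j\<in>{..<T}. hit (V j) b}" for b
      have "\<forall>b\<in>F. w b > 0" by (simp add: w_def)
      then obtain U where U: "U \<in> \<V>" "sum w F \<le> K * sum w {b\<in>F. hit U b}" using frac by blast
      define V' where "V' = V(T := U)"
      have step: "(1 / 2) ^ card {j\<in>{..<Suc T}. hit (V' j) b} = w b - (if hit U b then w b / 2 else 0)" for b
      proof -
        have eq: "{j\<in>{..<Suc T}. hit (V' j) b}
            = (if hit U b then insert T {j\<in>{..<T}. hit (V j) b} else {j\<in>{..<T}. hit (V j) b})"
          by (auto simp: V'_def less_Suc_eq)
        show ?thesis unfolding eq by (simp add: w_def)
      qed
      have "(\<Sum>b\<in>F. (1 / 2) ^ card {j\<in>{..<Suc T}. hit (V' j) b})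
          = sum w F - (\<Sum>b\<in>F. if hit U b then w b / 2 else 0)"
        by (simp only: step sum_subtractf)
      also have "(\<Sum>b\<in>F. if hit U b then w b / 2 else 0) = sum w {b\<in>F. hit U b} / 2"
        using F(1) by (simp add: sum_divide_distrib flip: sum.inter_filter)
      also have "sum w F - sum w {b\<in>F. hit U b} / 2 \<le> \<rho> * sum w F"
        using U(2) K by (simp add: \<rho>_def field_simps)
      also have "\<dots> \<le> \<rho> * (real n * \<rho> ^ T)"
        using V(2) \<rho> by (intro mult_left_mono) (simp_all add: w_def)
      finally have "(\<Sum>b\<in>F. (1 / 2) ^ card {j\<in>{..<Suc T}. hit (V' j) b}) \<le> real n * \<rho> ^ Suc T"
        by (simp add: mult_ac)
      moreover have "\<forall>j<Suc T. V' j \<in> \<V>" using V(1) U(1) by (simp add: V'_def less_Suc_eq)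
      ultimately show ?case by blast
    qed
    from this[of "q0 * n"] obtain V where V: "\<forall>j<q0 * n. V j \<in> \<V>"
      "(\<Sum>b\<in>F. (1 / 2) ^ card {j\<in>{..<q0 * n}. hit (V j) b}) \<le> real n * \<rho> ^ (q0 * n)" by blast
    have "q0 * n \<le> q0 * card {j\<in>{..<q0 * n}. hit (V j) b}" if b: "b \<in> F" for b
    proof -
      let ?c = "card {j\<in>{..<q0 * n}. hit (V j) b}"
      have "(1 / 2) ^ ?c \<le> (\<Sum>b\<in>F. (1 / 2 :: real) ^ card {j\<in>{..<q0 * n}. hit (V j) b})"
        using F(1) b by (intro member_le_sum) auto
      also have "\<dots> \<le> real n * (\<rho> ^ q0) ^ n" using V(2) by (simp add: power_mult)
      also have "\<dots> \<le> 2 ^ n * (1 / 4) ^ n"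
        using q0 \<rho> of_nat_less_two_power[of n, where 'a = real]
        by (intro mult_mono power_mono) (auto intro: less_imp_le)
      also have "\<dots> = (1 / 2) ^ n" by (simp flip: power_mult_distrib)
      finally have "n \<le> ?c" by simp
      then show ?thesis by simp
    qed
    moreover have "q0 * n > 0" using n \<open>q0 > 0\<close> by simp
    ultimately show "\<exists>T>0. \<exists>V. (\<forall>j<T. V j \<in> \<V>) \<and> (\<forall>b\<in>F. T \<le> q0 * card {j\<in>{..<T}. hit (V j) b})"
      using V(1) by blast
  qed
qed

section \<open>Coordinates of flats\<close>

text \<open>More vectors than the dimension are linearly dependent. A halfspace that selects exactly
  the nonnegative coefficients \<open>c j\<close> makes every term
  \<open>c j * (z j \<bullet> \<psi>)\<close> nonnegative, while the terms sum to 0.\<close>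

lemma card_shattered_by_halfspaces_le:
  fixes z :: "'j \<Rightarrow> 'e::euclidean_space"
  assumes S: "finite S" "shatters H S"
    and half: "\<And>h. h \<in> H \<Longrightarrow> \<exists>\<psi>. \<forall>j\<in>S. j \<in> h \<longleftrightarrow> 0 \<le> z j \<bullet> \<psi>"
  shows "card S \<le> DIM('e)"
proof (rule ccontr)
  assume big: "\<not> card S \<le> DIM('e)"
  have "\<exists>c. (\<exists>j\<in>S. c j \<noteq> 0) \<and> (\<Sum>j\<in>S. c j *\<^sub>R z j) = 0"
  proof (cases "inj_on z S")
    case True
    then have "card (z ` S) > DIM('e)" using big by (simp add: card_image)
    then have "dependent (z ` S)" by (intro dependent_biggerset) simp
    then obtain u where u: "\<exists>v\<in>z ` S. u v \<noteq> 0" "(\<Sum>v\<in>z ` S. u v *\<^sub>R v) = 0"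
      using S(1) by (auto simp: dependent_finite)
    show ?thesis
      by (rule exI[of _ "u \<circ> z"]) (use u True in \<open>auto simp: sum.reindex o_def\<close>)
  next
    case False
    then obtain i j where ij: "i \<in> S" "j \<in> S" "i \<noteq> j" "z i = z j" by (auto simp: inj_on_def)
    define c where "c x = (if x = i then 1 else 0) - (if x = j then 1 else (0::real))" for x
    have "(\<Sum>x\<in>S. c x *\<^sub>R z x) = 0"
      using ij S(1)
      by (simp add: c_def scaleR_left_diff_distrib sum_subtractf if_distrib[of "\<lambda>c. c *\<^sub>R _"] cong: if_cong)
    moreover have "c i \<noteq> 0" using ij by (simp add: c_def)
    ultimately show ?thesis using ij by blast
  qed
  then obtain c0 j0 where c0: "j0 \<in> S" "c0 j0 \<noteq> 0" "(\<Sum>j\<in>S. c0 j *\<^sub>R z j) = 0" by blast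
  \<comment> \<open>The sign is normalized so that some coefficient is negative: only outside a
    closed halfspace is \<open>z j \<bullet> \<psi>\<close> known to be nonzero, and this yields the
    strictly positive term.\<close>
  define c where "c j = - sgn (c0 j0) * c0 j" for j
  have "(\<Sum>j\<in>S. c j *\<^sub>R z j) = (- sgn (c0 j0)) *\<^sub>R (\<Sum>j\<in>S. c0 j *\<^sub>R z j)"
    unfolding c_def scaleR_sum_right by simp
  then have csum: "(\<Sum>j\<in>S. c j *\<^sub>R z j) = 0" using c0(3) by simp
  have cj0: "c j0 < 0" using c0(2) by (auto simp: c_def sgn_if)
  have "{j\<in>S. 0 \<le> c j} \<subseteq> S" by simp
  then obtain h where h: "h \<in> H" "h \<inter> S = {j\<in>S. 0 \<le> c j}"
    using S(2) unfolding shatters_def by meson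
  obtain \<psi> where \<psi>: "\<forall>j\<in>S. j \<in> h \<longleftrightarrow> 0 \<le> z j \<bullet> \<psi>" using half[OF h(1)] by blast
  have sign: "0 \<le> z j \<bullet> \<psi> \<longleftrightarrow> 0 \<le> c j" if "j \<in> S" for j
    using \<psi> h(2) that by blast
  have "0 < (\<Sum>j\<in>S. c j * (z j \<bullet> \<psi>))"
  proof (rule sum_pos2[OF S(1) c0(1)])
    show "0 < c j0 * (z j0 \<bullet> \<psi>)"
      using sign[OF c0(1)] cj0 by (intro mult_neg_neg) auto
    show "0 \<le> c j * (z j \<bullet> \<psi>)" if "j \<in> S" for j
      using sign[OF that] by (cases "0 \<le> c j") (auto intro: mult_nonpos_nonpos)
  qed
  also have "\<dots> = (\<Sum>j\<in>S. c j *\<^sub>R z j) \<bullet> \<psi>" by (simp add: inner_sum_left)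
  finally show False by (simp add: csum)
qed

text \<open>Rows in \<open>I\<close> are orthonormal and all other rows vanish. Fixing
  \<open>I\<close> of size \<open>k\<close> thus puts the codes of all \<open>k\<close>-flats into
  one type, and the frames form a compact set.\<close>

definition frame :: "'n set \<Rightarrow> real ^ 'n ^ 'n::finite \<Rightarrow> bool" where
  "frame I A \<longleftrightarrow> (\<forall>i j. A $ i \<bullet> A $ j = (if i = j \<and> i \<in> I then 1 else 0))"

definition flat_of :: "real ^ 'n \<Rightarrow> real ^ 'n ^ 'n::finite \<Rightarrow> (real ^ 'n) set" where
  "flat_of v A = (+) v ` span (range (($) A))"

text \<open>If \<open>A\<close> is a frame, this is \<open>r\<^sup>2\<close> minus the squared distance of \<open>x\<close> from \<open>flat_of v A\<close>.\<close>

definition margin :: "real ^ 'n \<Rightarrow> real ^ 'n ^ 'n::finite \<Rightarrow> real ^ 'n \<Rightarrow> real \<Rightarrow> real" where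
  "margin v A x r = r\<^sup>2 - (norm (x - v))\<^sup>2 + (\<Sum>i\<in>UNIV. (A $ i \<bullet> (x - v))\<^sup>2)"

lemma is_flat_flat_of:
  fixes A :: "real ^ 'n ^ 'n::finite"
  assumes "frame I A"
  shows "is_flat (card I) (flat_of v A)"
proof -
  have inner: "A $ i \<bullet> A $ j = (if i = j \<and> i \<in> I then 1 else 0)" for i j
    using assms by (simp add: frame_def)
  have zero: "A $ i = 0 \<longleftrightarrow> i \<notin> I" for i using inner[of i i] by (metis inner_eq_zero_iff zero_neq_one)
  have inj: "inj_on (($) A) I"
  proof (rule inj_onI)
    fix i j assume "i \<in> I" "j \<in> I" "A $ i = A $ j"
    then show "i = j" using inner[of i j] inner[of i i] by (metis zero_neq_one)
  qed
  have "independent (($) A ` I)"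
    by (rule pairwise_orthogonal_independent) (auto simp: pairwise_def orthogonal_def inner zero)
  then have "dim (($) A ` I) = card I" using inj by (simp add: dim_eq_card_independent card_image)
  moreover have "span (range (($) A)) = span (($) A ` I)"
  proof (rule span_eq[THEN iffD2], intro conjI subsetI)
    fix x assume "x \<in> range (($) A)"
    then obtain i where "x = A $ i" by auto
    then show "x \<in> span (($) A ` I)" using zero[of i] by (cases "i \<in> I") (auto intro: span_base span_zero)
  qed (auto intro: span_base)
  ultimately show ?thesis
    unfolding is_flat_def flat_of_def
    by (simp add: aff_dim_translation_eq aff_dim_subspace subspace_imp_affine flip: affine_translation)
qed

text \<open>The base point \<open>v\<close> may be any point of the flat. Taking it in a prescribed
  ball confines the code of a flat that hits this ball to a compact set.\<close>

lemma flat_of_exists: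
  fixes V :: "(real ^ 'n::finite) set"
  assumes V: "is_flat k V" and v: "v \<in> V" and I: "card (I :: 'n set) = k"
  shows "\<exists>A. frame I A \<and> V = flat_of v A"
proof -
  define S where "S = (+) (- v) ` V"
  have S: "subspace S" using V v affine_diffs_subspace by (auto simp: S_def is_flat_def)
  have "aff_dim V = int (dim S)"
    unfolding S_def using v by (intro aff_dim_eq_dim) (simp add: hull_inc)
  then have dimS: "dim S = k" using V by (simp add: is_flat_def)
  obtain B where B: "B \<subseteq> S" "pairwise orthogonal B" "\<And>x. x \<in> B \<Longrightarrow> norm x = 1"
      "independent B" "card B = dim S" "span B = S"
    using orthonormal_basis_subspace[OF S] by metis
  have "finite B" using B(4) by (rule independent_imp_finite)
  then obtain b where b: "bij_betw b I B"
    using B(5) dimS I by (metis finite finite_same_card_bij)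
  define A :: "real ^ 'n ^ 'n" where "A = (\<chi> i. if i \<in> I then b i else 0)"
  have "frame I A"
    unfolding frame_def
  proof (intro allI)
    fix i j
    have "b i \<bullet> b j = (if i = j then 1 else 0)" if "i \<in> I" "j \<in> I"
    proof -
      have "b i \<in> B" "b j \<in> B" "b i = b j \<longleftrightarrow> i = j"
        using b that by (auto simp: bij_betw_def inj_on_eq_iff)
      then show ?thesis using B(2,3) by (auto simp: pairwise_def orthogonal_def dot_square_norm)
    qed
    then show "A $ i \<bullet> A $ j = (if i = j \<and> i \<in> I then 1 else 0)" by (auto simp: A_def)
  qed
  moreover have "span (range (($) A)) = S"
  proof -
    have "range (($) A) \<subseteq> S"
      using b B(1) subspace_0[OF S] by (auto simp: A_def bij_betw_def)
    moreover have "B \<subseteq> range (($) A)"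
    proof
      fix x assume "x \<in> B"
      then obtain i where "i \<in> I" "x = b i" using b by (auto simp: bij_betw_def)
      then show "x \<in> range (($) A)" by (auto simp: A_def intro!: image_eqI[of _ _ i])
    qed
    ultimately show ?thesis using B(6) S by (metis span_mono span_subspace)
  qed
  moreover have "V = (+) v ` S" by (simp add: S_def image_image)
  ultimately show ?thesis by (auto simp: flat_of_def)
qed

text \<open>Here \<open>q\<close> is the orthogonal projection of \<open>x - v\<close> onto the
  direction space, hence the nearest point there by Pythagoras.\<close>

lemma hits_flat_of_iff:
  fixes A :: "real ^ 'n ^ 'n::finite"
  assumes A: "frame I A" and r: "r \<ge> 0"
  shows "hits (flat_of v A) (cball x r) \<longleftrightarrow> 0 \<le> margin v A x r"
proof -
  have inner: "A $ i \<bullet> A $ j = (if i = j \<and> i \<in> I then 1 else 0)" for i j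
    using A by (simp add: frame_def)
  define y where "y = x - v"
  define S where "S = span (range (($) A))"
  define q where "q = (\<Sum>i\<in>UNIV. (A $ i \<bullet> y) *\<^sub>R A $ i)"
  have qS: "q \<in> S" unfolding q_def S_def by (intro span_sum span_scale span_base) auto
  have Ai: "A $ i \<bullet> (y - q) = 0" for i
  proof -
    have "A $ i \<bullet> q = (\<Sum>j\<in>UNIV. if i = j then (if i \<in> I then A $ j \<bullet> y else 0) else 0)"
      unfolding q_def by (simp add: inner_sum_right inner if_distrib cong: if_cong) (auto intro!: sum.cong)
    also have "\<dots> = (if i \<in> I then A $ i \<bullet> y else 0)" by simp
    also have "\<dots> = A $ i \<bullet> y"
      using inner[of i i] by (auto simp: inner_eq_zero_iff)
    finally show ?thesis by (simp add: inner_diff_right)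
  qed
  have orth: "z \<bullet> (y - q) = 0" if "z \<in> S" for z
  proof -
    have "subspace {z. z \<bullet> (y - q) = 0}" by (simp add: subspace_hyperplane2 inner_commute)
    moreover have "range (($) A) \<subseteq> {z. z \<bullet> (y - q) = 0}" using Ai by auto
    ultimately show ?thesis using that span_minimal unfolding S_def by blast
  qed
  have "q \<bullet> y = (\<Sum>i\<in>UNIV. (A $ i \<bullet> y)\<^sup>2)"
    by (simp add: q_def inner_sum_left power2_eq_square)
  moreover have "q \<bullet> y = q \<bullet> q" using orth[OF qS] by (simp add: inner_diff_right)
  ultimately have dist: "(norm (y - q))\<^sup>2 = (norm y)\<^sup>2 - (\<Sum>i\<in>UNIV. (A $ i \<bullet> y)\<^sup>2)"
    by (simp add: power2_norm_eq_inner inner_diff_left inner_diff_right inner_commute)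
  have margin: "margin v A x r = r\<^sup>2 - (norm (y - q))\<^sup>2"
    using dist by (simp add: margin_def flip: y_def)
  have closest: "norm (y - q) \<le> norm (y - z)" if "z \<in> S" for z
  proof -
    have "(q - z) \<bullet> (y - q) = 0"
      by (simp only: inner_diff_left orth[OF that] orth[OF qS] diff_self)
    then have "(y - q) \<bullet> (q - z) = 0" by (simp only: inner_commute)
    then have "(norm (y - z))\<^sup>2 = (norm (y - q))\<^sup>2 + (norm (q - z))\<^sup>2"
      using norm_add_Pythagorean[of "y - q" "q - z"] by (simp add: orthogonal_def)
    then have "(norm (y - q))\<^sup>2 \<le> (norm (y - z))\<^sup>2" by simp
    then show ?thesis by (rule power2_le_imp_le) simp
  qed
  have "hits (flat_of v A) (cball x r) \<longleftrightarrow> (\<exists>z\<in>S. norm (y - z) \<le> r)"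
    by (auto simp: hits_def flat_of_def S_def y_def dist_norm algebra_simps)
  also have "\<dots> \<longleftrightarrow> norm (y - q) \<le> r" using closest qS order_trans by blast
  also have "\<dots> \<longleftrightarrow> (norm (y - q))\<^sup>2 \<le> r\<^sup>2" using r by (simp add: power2_le_iff_abs_le)
  also have "\<dots> \<longleftrightarrow> 0 \<le> margin v A x r" by (simp add: margin)
  finally show ?thesis .
qed

type_synonym 'n flat_code = "(real ^ 'n ^ 'n) \<times> (real ^ 'n) \<times> real \<times> real"

text \<open>Expanding the squares separates flat and ball: the first vector depends only on the
  flat, the second only on the ball. For a frame, the matrix block is the projection matrix onto the
  direction space. The dimension of the code space is the bound on shattered sets.\<close>

lemma margin_linear:
  fixes A :: "real ^ 'n ^ 'n::finite"
  shows "margin v A x r =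
    ((\<chi> a b. \<Sum>i\<in>UNIV. A $ i $ a * A $ i $ b, v - (\<Sum>i\<in>UNIV. (A $ i \<bullet> v) *\<^sub>R A $ i),
      (\<Sum>i\<in>UNIV. (A $ i \<bullet> v)\<^sup>2) - (norm v)\<^sup>2, 1) :: 'n flat_code) \<bullet>
    (\<chi> a b. x $ a * x $ b, 2 *\<^sub>R x, 1, r\<^sup>2 - (norm x)\<^sup>2)"
proof -
  have "((\<chi> a b. \<Sum>i\<in>UNIV. A $ i $ a * A $ i $ b) :: real ^ 'n ^ 'n) \<bullet> (\<chi> a b. x $ a * x $ b)
      = (\<Sum>a\<in>UNIV. \<Sum>b\<in>UNIV. \<Sum>i\<in>UNIV. (A $ i $ a * x $ a) * (A $ i $ b * x $ b))"
    by (simp add: inner_vec_def sum_distrib_right sum_distrib_left mult_ac)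
  also have "\<dots> = (\<Sum>i\<in>UNIV. \<Sum>a\<in>UNIV. \<Sum>b\<in>UNIV. (A $ i $ a * x $ a) * (A $ i $ b * x $ b))"
    by (subst sum.swap, subst (2) sum.swap, rule refl)
  also have "\<dots> = (\<Sum>i\<in>UNIV. (A $ i \<bullet> x)\<^sup>2)"
    by (simp add: inner_vec_def power2_eq_square sum_product)
  finally have quad: "((\<chi> a b. \<Sum>i\<in>UNIV. A $ i $ a * A $ i $ b) :: real ^ 'n ^ 'n) \<bullet> (\<chi> a b. x $ a * x $ b)
      = (\<Sum>i\<in>UNIV. (A $ i \<bullet> x)\<^sup>2)" .
  have lin: "(\<Sum>i\<in>UNIV. (A $ i \<bullet> v) *\<^sub>R A $ i) \<bullet> x = (\<Sum>i\<in>UNIV. (A $ i \<bullet> v) * (A $ i \<bullet> x))"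
    by (simp add: inner_sum_left)
  have "(\<Sum>i\<in>UNIV. (A $ i \<bullet> (x - v))\<^sup>2)
      = (\<Sum>i\<in>UNIV. (A $ i \<bullet> x)\<^sup>2) + (\<Sum>i\<in>UNIV. (A $ i \<bullet> v)\<^sup>2) - 2 * (\<Sum>i\<in>UNIV. (A $ i \<bullet> v) * (A $ i \<bullet> x))"
    by (simp add: inner_diff_right power2_diff sum.distrib sum_subtractf sum_distrib_left mult_ac)
  moreover have "(norm (x - v))\<^sup>2 = (norm x)\<^sup>2 - 2 * (v \<bullet> x) + (norm v)\<^sup>2"
    by (simp add: power2_norm_eq_inner inner_diff_left inner_diff_right inner_commute)
  ultimately show ?thesis
    by (simp add: margin_def quad inner_diff_left lin algebra_simps)
qed

text \<open>This is the dual set system: the indices of the flats are the ground set and the balls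
  are the ranges. Each flat becomes a point \<open>z j\<close> of the code space, and each ball a
  halfspace.\<close>

lemma card_shattered_by_balls_le:
  fixes V :: "nat \<Rightarrow> (real ^ 'n::finite) set"
  assumes k: "k \<le> CARD('n)" and V: "\<And>j. j < T \<Longrightarrow> is_flat k (V j)"
    and F: "\<And>B. B \<in> \<F> \<Longrightarrow> is_closed_ball B"
    and S: "S \<subseteq> {..<T}" "shatters ((\<lambda>B. {j\<in>{..<T}. hits (V j) B}) ` \<F>) S"
  shows "card S \<le> DIM('n flat_code)"
proof -
  obtain I :: "'n set" where I: "card I = k" using obtain_subset_with_card_n[of k "UNIV :: 'n set"] k by auto
  have "\<forall>j\<in>{..<T}. \<exists>c. frame I (snd c) \<and> V j = flat_of (fst c) (snd c)"
  proof
    fix j assume "j \<in> {..<T}"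
    then have j: "j < T" by simp
    have "V j \<noteq> {}" using V[OF j] by (auto simp: is_flat_def)
    then obtain v where "v \<in> V j" by blast
    then show "\<exists>c. frame I (snd c) \<and> V j = flat_of (fst c) (snd c)"
      using flat_of_exists[OF V[OF j] _ I, of v] by auto
  qed
  then have "\<exists>c. \<forall>j\<in>{..<T}. frame I (snd (c j)) \<and> V j = flat_of (fst (c j)) (snd (c j))"
    by (rule bchoice)
  then obtain c where c: "\<forall>j\<in>{..<T}. frame I (snd (c j)) \<and> V j = flat_of (fst (c j)) (snd (c j))" ..
  define A where "A j = snd (c j)" for j
  define v where "v j = fst (c j)" for j
  have Av: "frame I (A j)" "V j = flat_of (v j) (A j)" if "j < T" for j
    using c that by (simp_all add: A_def v_def)
  define z :: "nat \<Rightarrow> 'n flat_code" where "z j =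
    (\<chi> a b. \<Sum>i\<in>UNIV. A j $ i $ a * A j $ i $ b, v j - (\<Sum>i\<in>UNIV. (A j $ i \<bullet> v j) *\<^sub>R A j $ i),
      (\<Sum>i\<in>UNIV. (A j $ i \<bullet> v j)\<^sup>2) - (norm (v j))\<^sup>2, 1)" for j
  show ?thesis
  proof (rule card_shattered_by_halfspaces_le[OF _ S(2), where z = z])
    show "finite S" using S(1) finite_subset by auto
    fix h assume "h \<in> (\<lambda>B. {j\<in>{..<T}. hits (V j) B}) ` \<F>"
    then obtain B where B: "B \<in> \<F>" "h = {j\<in>{..<T}. hits (V j) B}" by auto
    obtain x r where xr: "B = cball x r" "r > 0" using F[OF B(1)] by (auto simp: is_closed_ball_def)
    define \<psi> :: "'n flat_code" where "\<psi> = (\<chi> a b. x $ a * x $ b, 2 *\<^sub>R x, 1, r\<^sup>2 - (norm x)\<^sup>2)"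
    have "j \<in> h \<longleftrightarrow> 0 \<le> z j \<bullet> \<psi>" if "j \<in> S" for j
    proof -
      have j: "j < T" using that S(1) by auto
      then have "j \<in> h \<longleftrightarrow> 0 \<le> margin (v j) (A j) x r"
        using xr hits_flat_of_iff[OF Av(1)[OF j], of r "v j" x] by (simp add: B(2) Av(2))
      then show ?thesis by (simp only: margin_linear z_def \<psi>_def)
    qed
    then show "\<exists>\<psi>. \<forall>j\<in>S. j \<in> h \<longleftrightarrow> 0 \<le> z j \<bullet> \<psi>" by blast
  qed
qed

section \<open>Compactness: from finite subfamilies to infinite families\<close>

definition covered :: "nat \<Rightarrow> nat \<Rightarrow> 'a::euclidean_space set set \<Rightarrow> bool" where
  "covered k m \<F> \<longleftrightarrow> (\<exists>\<T>. finite \<T> \<and> card \<T> \<le> m \<and> (\<forall>V\<in>\<T>. is_flat k V) \<and> (\<forall>B\<in>\<F>. \<exists>V\<in>\<T>. hits V B))"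

lemma compact_frames: "compact {A :: real ^ 'n ^ 'n::finite. frame I A}"
proof -
  have "closed {A :: real ^ 'n ^ 'n. frame I A}"
    unfolding frame_def by (intro closed_Collect_all closed_Collect_eq continuous_intros)
  moreover have "bounded {A :: real ^ 'n ^ 'n. frame I A}"
  proof -
    have "norm A \<le> (\<Sum>i\<in>(UNIV :: 'n set). 1)" if "frame I A" for A :: "real ^ 'n ^ 'n"
    proof -
      have "norm (A $ i) \<le> 1" for i
        using that by (simp add: frame_def norm_eq_sqrt_inner)
      then have "(\<Sum>i\<in>UNIV. norm (A $ i)) \<le> (\<Sum>i\<in>(UNIV :: 'n set). 1)" by (intro sum_mono)
      moreover have "norm A \<le> (\<Sum>i\<in>UNIV. norm (A $ i))"
        unfolding norm_vec_def[of A] by (rule L2_set_le_sum) simp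
      ultimately show ?thesis by (rule order_trans[rotated])
    qed
    then show ?thesis unfolding bounded_iff by blast
  qed
  ultimately show ?thesis by (simp add: compact_eq_bounded_closed)
qed

text \<open>Compactness of the set of flats that hit a fixed ball replaces a compactness argument for
  \<open>m\<close>-tuples of flats: if removing the balls hit by any one such flat never leaves an \<open>m\<close>-coverable
  family, then finitely many finite obstructions suffice for all of these flats.\<close>

lemma covered_if_finite_subfamilies_covered:
  fixes \<F> :: "(real ^ 'n::finite) set set"
  assumes k: "k \<le> CARD('n)" and "\<And>B. B \<in> \<F> \<Longrightarrow> is_closed_ball B"
    and "\<And>\<G>. \<G> \<subseteq> \<F> \<Longrightarrow> finite \<G> \<Longrightarrow> covered k m \<G>"
  shows "covered k m \<F>"
  using assms(2,3)
proof (induction m arbitrary: \<F>)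
  case 0
  have "\<F> = {}"
  proof (rule ccontr)
    assume "\<F> \<noteq> {}"
    then obtain B where "B \<in> \<F>" by auto
    then have "covered k 0 {B}" using 0(2)[of "{B}"] by simp
    then show False by (auto simp: covered_def)
  qed
  then show ?case unfolding covered_def by (intro exI[of _ "{}"]) simp
next
  case (Suc m)
  show ?case
  proof (cases "\<F> = {}")
    case True
    then show ?thesis unfolding covered_def by (intro exI[of _ "{}"]) simp
  next
    case False
    then obtain B0 where B0: "B0 \<in> \<F>" by auto
    obtain I :: "'n set" where I: "card I = k" using obtain_subset_with_card_n[of k "UNIV :: 'n set"] k by auto
    have "\<forall>B\<in>\<F>. \<exists>x r. r > 0 \<and> B = cball x r" using Suc.prems(1) by (simp add: is_closed_ball_def)
    then obtain x where "\<forall>B\<in>\<F>. \<exists>r. r > 0 \<and> B = cball (x B) r" using bchoice by meson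
    then obtain r where "\<forall>B\<in>\<F>. r B > 0 \<and> B = cball (x B) (r B)" using bchoice by meson
    then have xr: "r B > 0" "B = cball (x B) (r B)" if "B \<in> \<F>" for B using that by blast+
    define K where "K = B0 \<times> {A :: real ^ 'n ^ 'n. frame I A}"
    define fl where "fl c = flat_of (fst c) (snd c)" for c :: "(real ^ 'n) \<times> (real ^ 'n ^ 'n)"
    define gap where "gap c B = margin (fst c) (snd c) (x B) (r B)" for c B
    have K: "compact K"
      unfolding K_def using compact_cball[of "x B0" "r B0"] xr(2)[OF B0] compact_frames
      by (intro compact_Times) auto
    have hit_iff: "hits (fl c) B \<longleftrightarrow> 0 \<le> gap c B" if "c \<in> K" "B \<in> \<F>" for c B
      using hits_flat_of_iff[of I "snd c" "r B" "fst c" "x B"] that xr(1)[OF that(2)] xr(2)[OF that(2)]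
      by (auto simp: K_def fl_def gap_def less_imp_le)
    have flat: "is_flat k (fl c)" if "c \<in> K" for c
      using is_flat_flat_of[of I "snd c" "fst c"] that I by (auto simp: K_def fl_def)
    have code: "\<exists>c\<in>K. V = fl c" if "is_flat k V" "hits V B0" for V
    proof -
      obtain v where "v \<in> V" "v \<in> B0" using \<open>hits V B0\<close> by (auto simp: hits_def)
      then show ?thesis using flat_of_exists[OF \<open>is_flat k V\<close> _ I, of v]
        by (auto simp: K_def fl_def)
    qed
    show ?thesis
    proof (cases "\<exists>c\<in>K. \<forall>\<G>. \<G> \<subseteq> {B\<in>\<F>. \<not> hits (fl c) B} \<longrightarrow> finite \<G> \<longrightarrow> covered k m \<G>")
      case True
      then obtain c where c: "c \<in> K"
        and cov: "\<forall>\<G>. \<G> \<subseteq> {B\<in>\<F>. \<not> hits (fl c) B} \<longrightarrow> finite \<G> \<longrightarrow> covered k m \<G>" ..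
      have "covered k m {B\<in>\<F>. \<not> hits (fl c) B}"
      proof (rule Suc.IH)
        show "is_closed_ball B" if "B \<in> {B\<in>\<F>. \<not> hits (fl c) B}" for B
          using that Suc.prems(1) by simp
        show "covered k m \<G>" if "\<G> \<subseteq> {B\<in>\<F>. \<not> hits (fl c) B}" "finite \<G>" for \<G>
          using cov that by simp
      qed
      then obtain \<T> where \<T>: "finite \<T>" "card \<T> \<le> m" "\<forall>V\<in>\<T>. is_flat k V"
        "\<forall>B\<in>{B\<in>\<F>. \<not> hits (fl c) B}. \<exists>V\<in>\<T>. hits V B"
        unfolding covered_def by blast
      have "card (insert (fl c) \<T>) \<le> Suc m" using \<T>(1,2) by (simp add: card_insert_if)
      moreover have "\<forall>B\<in>\<F>. \<exists>V\<in>insert (fl c) \<T>. hits V B" using \<T>(4) by blast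
      ultimately show ?thesis
        unfolding covered_def using \<T>(1,3) flat[OF c]
        by (intro exI[of _ "insert (fl c) \<T>"]) simp
    next
      case False
      then have "\<forall>c\<in>K. \<exists>\<G>. \<G> \<subseteq> {B\<in>\<F>. \<not> hits (fl c) B} \<and> finite \<G> \<and> \<not> covered k m \<G>" by blast
      then have "\<exists>\<G>. \<forall>c\<in>K. \<G> c \<subseteq> {B\<in>\<F>. \<not> hits (fl c) B} \<and> finite (\<G> c) \<and> \<not> covered k m (\<G> c)"
        by (rule bchoice)
      then obtain \<G> where "\<forall>c\<in>K. \<G> c \<subseteq> {B\<in>\<F>. \<not> hits (fl c) B} \<and> finite (\<G> c) \<and> \<not> covered k m (\<G> c)" ..
      then have \<G>: "\<G> c \<subseteq> {B\<in>\<F>. \<not> hits (fl c) B}" "finite (\<G> c)" "\<not> covered k m (\<G> c)" if "c \<in> K" for c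
        using that by blast+
      \<comment> \<open>Codes near \<open>c\<close> whose flats still miss the finite obstruction
        \<open>\<G> c\<close>. The empty default makes \<open>O' c\<close> open for every
        \<open>c\<close>.\<close>
      define O' where "O' c = {c'. \<forall>B\<in>(if c \<in> K then \<G> c else {}). gap c' B < 0}" for c
      have "open (O' c)" for c
      proof -
        have "open {c'. gap c' B < 0}" for B
          unfolding gap_def margin_def by (intro open_Collect_less continuous_intros)
        then have "open (\<Inter>B\<in>(if c \<in> K then \<G> c else {}). {c'. gap c' B < 0})"
          using \<G>(2) by (intro open_INT) auto
        moreover have "O' c = (\<Inter>B\<in>(if c \<in> K then \<G> c else {}). {c'. gap c' B < 0})"
          by (auto simp: O'_def)
        ultimately show ?thesis by simp
      qed
      moreover have "K \<subseteq> (\<Union>c\<in>K. O' c)"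
      proof
        fix c assume c: "c \<in> K"
        have "gap c B < 0" if "B \<in> \<G> c" for B
          using \<G>(1)[OF c] that hit_iff[OF c, of B] by auto
        then have "c \<in> O' c" by (simp add: O'_def)
        then show "c \<in> (\<Union>c\<in>K. O' c)" using c by blast
      qed
      ultimately obtain C where C: "C \<subseteq> K" "finite C" "K \<subseteq> (\<Union>c\<in>C. O' c)"
        using compactE_image[OF K, of K O'] by metis
      \<comment> \<open>Including \<open>B0\<close> forces a cover of \<open>\<H>\<close> to contain
        a flat with a code in \<open>K\<close>. That flat misses some obstruction
        \<open>\<G> c\<close> entirely, so the other \<open>m\<close> flats would cover
        \<open>\<G> c\<close>.\<close>
      define \<H> where "\<H> = insert B0 (\<Union>c\<in>C. \<G> c)"
      have "\<H> \<subseteq> \<F>" using B0 \<G>(1) C(1) by (auto simp: \<H>_def)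
      moreover have "finite \<H>" using C(1,2) \<G>(2) by (auto simp: \<H>_def)
      ultimately have "covered k (Suc m) \<H>" by (rule Suc.prems(2))
      then obtain \<T> where \<T>: "finite \<T>" "card \<T> \<le> Suc m" "\<forall>V\<in>\<T>. is_flat k V" "\<forall>B\<in>\<H>. \<exists>V\<in>\<T>. hits V B"
        unfolding covered_def by blast
      obtain V where V: "V \<in> \<T>" "hits V B0" using \<T>(4) by (auto simp: \<H>_def)
      then obtain c' where c': "c' \<in> K" "V = fl c'" using code \<T>(3) by blast
      then obtain c where c: "c \<in> C" "c' \<in> O' c" using C(3) by blast
      have cK: "c \<in> K" using c(1) C(1) by blast
      have "\<exists>U\<in>\<T> - {V}. hits U B" if B: "B \<in> \<G> c" for B
      proof -
        have "B \<in> \<F>" using B \<G>(1)[OF cK] by blast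
        moreover have "gap c' B < 0" using c(2) B cK by (simp add: O'_def)
        ultimately have "\<not> hits V B" using hit_iff[OF c'(1)] c'(2) by auto
        moreover obtain U where "U \<in> \<T>" "hits U B" using \<T>(4) B c(1) by (auto simp: \<H>_def)
        ultimately show ?thesis by blast
      qed
      moreover have "card (\<T> - {V}) \<le> m" using \<T>(1,2) V(1) by simp
      ultimately have "covered k m (\<G> c)"
        unfolding covered_def using \<T>(1,3) by (intro exI[of _ "\<T> - {V}"]) simp
      then show ?thesis using \<G>(3)[OF cK] by contradiction
    qed
  qed
qed

section \<open>Transversals of families of balls\<close>

lemma fractional_hitting:
  assumes k: "k \<le> DIM('a::euclidean_space)"
  shows "\<exists>K::real. K \<ge> 1 \<and> (\<forall>(\<F> :: 'a set set) w. finite \<F> \<longrightarrow> \<F> \<noteq> {} \<longrightarrow> (\<forall>B\<in>\<F>. is_closed_ball B) \<longrightarrow>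
    flat_pq_property p (k + 2) k \<F> \<longrightarrow> (\<forall>B\<in>\<F>. w B > 0) \<longrightarrow>
    (\<exists>V\<in>{V. is_flat k V}. sum w \<F> \<le> K * sum w {B\<in>\<F>. hits V B}))"
proof -
  have "1 / (2 * (real k + 1)) > 0" by simp
  from finite_net_cball[OF this] obtain N :: "'a set" where "finite N \<and> 0 \<in> N \<and>
    (\<forall>u\<in>cball 0 2. \<exists>y\<in>N. dist u y \<le> 1 / (2 * (real k + 1)))" ..
  then have N: "finite N" "0 \<in> N"
    "\<And>u. u \<in> cball 0 2 \<Longrightarrow> \<exists>y\<in>N. dist u y \<le> 1 / (2 * (real k + 1))"
    by blast+
  \<comment> \<open>A recipe: target position \<open>l\<close>, positions \<open>J\<close> of the
    balls that span the flat, and net points \<open>n\<close>, extensional so that \<open>M\<close>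
    is finite. The bound on \<open>card J\<close> is an inequality because a repeated ball needs
    only one other position.\<close>
  define M :: "(nat \<times> nat set \<times> (nat \<Rightarrow> 'a)) set" where
    "M = {(l, J, n). l < p \<and> J \<subseteq> {..<p} - {l} \<and> card J \<le> k + 1 \<and> n \<in> PiE {..<p} (\<lambda>_. N)}"
  have "M \<subseteq> {..<p} \<times> Pow {..<p} \<times> PiE {..<p} (\<lambda>_. N)" unfolding M_def by blast
  moreover have "finite (PiE {..<p} (\<lambda>_. N))" using N(1) by (intro finite_PiE) simp_all
  ultimately have finM: "finite M" by (meson finite_SigmaI finite_Pow_iff finite_lessThan finite_subset)
  show ?thesis
  proof (rule exI[of _ "real (card M) + 1"], intro conjI allI impI)
    fix \<F> :: "'a set set" and w
    assume F: "finite \<F>" "\<F> \<noteq> {}" and balls: "\<forall>B\<in>\<F>. is_closed_ball B"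
      and pq: "flat_pq_property p (k + 2) k \<F>" and w: "\<forall>B\<in>\<F>. w B > (0::real)"
    have "\<forall>B\<in>\<F>. \<exists>x r. r > 0 \<and> B = cball x r" using balls by (simp add: is_closed_ball_def)
    then obtain x where "\<forall>B\<in>\<F>. \<exists>r. r > 0 \<and> B = cball (x B) r" using bchoice by meson
    then obtain r where "\<forall>B\<in>\<F>. r B > 0 \<and> B = cball (x B) (r B)" using bchoice by meson
    then have xr: "r B > 0" "cball (x B) (r B) = B" if "B \<in> \<F>" for B using that by simp_all
    define y where "y n t i = x (t i) + r (t i) *\<^sub>R n i" for n :: "nat \<Rightarrow> 'a" and t and i :: nat
    define f where "f m t = (SOME V. is_flat k V \<and> y (snd (snd m)) t ` fst (snd m) \<subseteq> V)"
      for m :: "nat \<times> nat set \<times> (nat \<Rightarrow> 'a)" and t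
    have f: "is_flat k (f (l, J, n) t)" "\<And>i. i \<in> J \<Longrightarrow> y n t i \<in> f (l, J, n) t"
      if "(l, J, n) \<in> M" for l J n t
    proof -
      have J: "J \<subseteq> {..<p} - {l}" "card J \<le> k + 1" using that by (simp_all add: M_def)
      have "finite J" by (rule finite_subset[OF J(1)]) simp
      then have "card (y n t ` J) \<le> k + 1" using card_image_le[of J "y n t"] J(2) by linarith
      then have "\<exists>V. is_flat k V \<and> y n t ` J \<subseteq> V"
        using \<open>finite J\<close> k by (intro flat_through_points) auto
      then have "is_flat k (f (l, J, n) t) \<and> y n t ` J \<subseteq> f (l, J, n) t"
        unfolding f_def fst_conv snd_conv by (rule someI_ex)
      then show "is_flat k (f (l, J, n) t)" "\<And>i. i \<in> J \<Longrightarrow> y n t i \<in> f (l, J, n) t" by blast+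
    qed
    have "\<exists>m\<in>M. \<exists>t\<in>PiE {..<p} (\<lambda>_. \<F>).
        sum w \<F> \<le> real (card M) * sum w {B\<in>\<F>. hits (f m t) B}"
    proof (rule heavy_set_of_tuples[where pos = fst, OF F _ finM])
      show "w B > 0" if "B \<in> \<F>" for B using w that by blast
      show "fst m < p" if "m \<in> M" for m using that by (auto simp: M_def)
      show "f m (t(fst m := B)) = f m t" if "m \<in> M" for m t B
      proof -
        have "y n (t(fst m := B)) ` fst (snd m) = y n t ` fst (snd m)" for n
          using that by (intro image_cong) (auto simp: M_def y_def)
        then show ?thesis by (simp add: f_def)
      qed
      fix t assume t: "t \<in> PiE {..<p} (\<lambda>_. \<F>)"
      then have tF: "t i \<in> \<F>" if "i < p" for i using that by (auto simp: PiE_iff)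
      show "\<exists>m\<in>M. hits (f m t) (t (fst m))"
      proof (cases "inj_on t {..<p}")
        case False
        then obtain i j where ij: "i < p" "j < p" "i \<noteq> j" "t i = t j" by (auto simp: inj_on_def)
        \<comment> \<open>The hypothesis concerns \<open>p\<close> different balls, but a product
          measure also charges tuples with repetitions. There a flat through the centre of
          \<open>t j\<close> hits the target \<open>t i\<close>. In a family of fewer than
          \<open>p\<close> balls every tuple is of this kind.\<close>
        let ?n = "\<lambda>i\<in>{..<p}. 0 :: 'a"
        have m: "(i, {j}, ?n) \<in> M" using ij N(2) by (auto simp: M_def)
        have "x (t i) \<in> f (i, {j}, ?n) t" using f(2)[OF m, of j t] ij by (simp add: y_def)
        moreover have "x (t i) \<in> cball (x (t i)) (r (t i))" using xr(1)[OF tF[OF ij(1)]] by simp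
        then have "x (t i) \<in> t i" using xr(2)[OF tF[OF ij(1)]] by simp
        ultimately have "hits (f (i, {j}, ?n) t) (t i)" unfolding hits_def by blast
        then show ?thesis using m by (intro bexI[of _ "(i, {j}, ?n)"]) simp_all
      next
        case True
        have "t ` {..<p} \<subseteq> \<F>" "finite (t ` {..<p})" "card (t ` {..<p}) = p"
          using tF True by (auto simp: card_image)
        then obtain \<H> V where H: "\<H> \<subseteq> t ` {..<p}" "card \<H> = k + 2" "is_flat k V" "\<And>B. B \<in> \<H> \<Longrightarrow> hits V B"
          using pq unfolding flat_pq_property_def by meson
        define I where "I = {i\<in>{..<p}. t i \<in> \<H>}"
        have "t ` I = \<H>" using H(1) by (auto simp: I_def)
        moreover have "inj_on t I" using True by (rule inj_on_subset) (auto simp: I_def)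
        ultimately have I: "finite I" "card I = k + 2" using H(2) by (auto simp: I_def dest: card_image)
        have Ip: "i < p" "t i \<in> \<H>" if "i \<in> I" for i using that by (auto simp: I_def)
        have hitI: "hits V (cball (x (t i)) (r (t i)))" if "i \<in> I" for i
          using H(4)[OF Ip(2)[OF that]] xr(2)[OF tF[OF Ip(1)[OF that]]] by simp
        have rI: "r (t i) > 0" if "i \<in> I" for i using xr(1)[OF tF[OF Ip(1)[OF that]]] .
        have "\<exists>l\<in>I. \<exists>n. (\<forall>i. n i \<in> N) \<and>
            (\<forall>V'. affine V' \<longrightarrow> (\<forall>i\<in>I - {l}. x (t i) + r (t i) *\<^sub>R n i \<in> V') \<longrightarrow>
              hits V' (cball (x (t l)) (r (t l))))"
          by (rule hit_by_net_flat[OF I H(3) hitI rI N(3)])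
        then obtain l n where l: "l \<in> I" and n: "\<And>i. n i \<in> N"
          and hit: "\<And>V'. affine V' \<Longrightarrow> \<forall>i\<in>I - {l}. x (t i) + r (t i) *\<^sub>R n i \<in> V' \<Longrightarrow>
            hits V' (cball (x (t l)) (r (t l)))"
          by blast
        let ?m = "(l, I - {l}, restrict n {..<p})"
        have m: "?m \<in> M" using l n Ip(1) I by (auto simp: M_def)
        have "hits (f ?m t) (cball (x (t l)) (r (t l)))"
        proof (rule hit)
          show "affine (f ?m t)" using f(1)[OF m, of t] by (simp add: is_flat_def)
          show "\<forall>i\<in>I - {l}. x (t i) + r (t i) *\<^sub>R n i \<in> f ?m t"
            using f(2)[OF m, of _ t] Ip(1) by (simp add: y_def)
        qed
        then have "hits (f ?m t) (t l)" using xr(2)[OF tF[OF Ip(1)[OF l]]] by simp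
        then show ?thesis using m by (intro bexI[of _ ?m]) simp_all
      qed
    qed
    then obtain m t where m: "m \<in> M" "sum w \<F> \<le> real (card M) * sum w {B\<in>\<F>. hits (f m t) B}" by blast
    have "0 \<le> sum w {B\<in>\<F>. hits (f m t) B}" using w by (intro sum_nonneg) (auto intro: less_imp_le)
    then have "sum w \<F> \<le> (real (card M) + 1) * sum w {B\<in>\<F>. hits (f m t) B}"
      using m(2) by (simp add: distrib_right)
    moreover have "is_flat k (f m t)" using f(1) m(1) by (cases m) simp
    ultimately show "\<exists>V\<in>{V. is_flat k V}. sum w \<F> \<le> (real (card M) + 1) * sum w {B\<in>\<F>. hits V B}" by blast
  qed simp
qed

text \<open>The order of choices makes the bound uniform: \<open>K\<close> depends on
  \<open>k\<close>, \<open>p\<close> and the dimension, \<open>q\<close> on \<open>K\<close>, and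
  \<open>s\<close> on \<open>q\<close> and the dimension of the code space. All are fixed before the
  family.\<close>

lemma finite_families_covered:
  assumes k: "k \<le> CARD('n::finite)"
  shows "\<exists>C. \<forall>\<F> :: (real ^ 'n) set set. finite \<F> \<longrightarrow> (\<forall>B\<in>\<F>. is_closed_ball B) \<longrightarrow>
    flat_pq_property p (k + 2) k \<F> \<longrightarrow> covered k C \<F>"
proof -
  have "k \<le> DIM(real ^ 'n)" using k by simp
  from fractional_hitting[OF this, of p]
  obtain K :: real where K: "K \<ge> 1 \<and> (\<forall>(\<F> :: (real ^ 'n) set set) w. finite \<F> \<longrightarrow> \<F> \<noteq> {} \<longrightarrow>
    (\<forall>B\<in>\<F>. is_closed_ball B) \<longrightarrow> flat_pq_property p (k + 2) k \<F> \<longrightarrow> (\<forall>B\<in>\<F>. w B > 0) \<longrightarrow>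
    (\<exists>V\<in>{V. is_flat k V}. sum w \<F> \<le> K * sum w {B\<in>\<F>. hits V B}))" ..
  note frac = K[THEN conjunct2, rule_format]
  from frequent_hits_of_fractional_hits[OF K[THEN conjunct1]]
  obtain q where q: "q > 0 \<and> (\<forall>(\<F> :: (real ^ 'n) set set) (\<V> :: (real ^ 'n) set set) hit.
    finite \<F> \<longrightarrow> \<F> \<noteq> {} \<longrightarrow>
    (\<forall>w. (\<forall>b\<in>\<F>. w b > 0) \<longrightarrow> (\<exists>V\<in>\<V>. sum w \<F> \<le> K * sum w {b\<in>\<F>. hit V b})) \<longrightarrow>
    (\<exists>T>0. \<exists>V. (\<forall>j<T. V j \<in> \<V>) \<and> (\<forall>b\<in>\<F>. T \<le> q * card {j\<in>{..<T}. hit (V j) b})))" ..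
  from bounded_net[OF q[THEN conjunct1], where D = "DIM('n flat_code)"]
  obtain s where s: "\<forall>(P :: nat set) H. finite P \<longrightarrow> P \<noteq> {} \<longrightarrow>
    (\<forall>h\<in>H. h \<subseteq> P \<and> card P \<le> q * card h) \<longrightarrow>
    (\<forall>S\<subseteq>P. shatters H S \<longrightarrow> card S \<le> DIM('n flat_code)) \<longrightarrow>
    (\<exists>X\<subseteq>P. card X \<le> s \<and> (\<forall>h\<in>H. h \<inter> X \<noteq> {}))" ..
  show ?thesis
  proof (rule exI[of _ s], intro allI impI)
    fix \<F> :: "(real ^ 'n) set set"
    assume F: "finite \<F>" "\<forall>B\<in>\<F>. is_closed_ball B" "flat_pq_property p (k + 2) k \<F>"
    show "covered k s \<F>"
    proof (cases "\<F> = {}")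
      case True
      then show ?thesis unfolding covered_def by (intro exI[of _ "{}"]) simp
    next
      case False
      have "\<exists>T>0. \<exists>V. (\<forall>j<T. V j \<in> {V. is_flat k V}) \<and>
          (\<forall>B\<in>\<F>. T \<le> q * card {j\<in>{..<T}. hits (V j) B})"
      proof (rule q[THEN conjunct2, THEN spec, THEN spec, THEN spec, THEN mp, THEN mp, THEN mp, OF F(1) False],
          intro allI impI)
        fix w assume "\<forall>B\<in>\<F>. w B > (0::real)"
        then show "\<exists>V\<in>{V. is_flat k V}. sum w \<F> \<le> K * sum w {B\<in>\<F>. hits V B}"
          using F(2) by (intro frac[OF F(1) False _ F(3)]) simp_all
      qed
      then obtain T V where T: "T > 0" and V: "\<forall>j<T. V j \<in> {V. is_flat k V}"
        "\<forall>B\<in>\<F>. T \<le> q * card {j\<in>{..<T}. hits (V j) B}"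
        by (elim exE conjE)
      \<comment> \<open>The ground set consists of rounds, not flats, so a flat repeated in the list
        keeps its multiplicity and each range occupies a fraction \<open>1 / q\<close>.\<close>
      define H where "H = (\<lambda>B. {j\<in>{..<T}. hits (V j) B}) ` \<F>"
      have "\<exists>X\<subseteq>{..<T}. card X \<le> s \<and> (\<forall>h\<in>H. h \<inter> X \<noteq> {})"
      proof (intro s[THEN spec, THEN spec, THEN mp, THEN mp, THEN mp, THEN mp] ballI allI impI)
        show "{..<T} \<noteq> {}" using T by auto
        show "h \<subseteq> {..<T} \<and> card {..<T} \<le> q * card h" if "h \<in> H" for h
          using that V(2) by (auto simp: H_def)
        show "card S \<le> DIM('n flat_code)" if "S \<subseteq> {..<T}" "shatters H S" for S
        proof (rule card_shattered_by_balls_le[OF k])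
          show "is_flat k (V j)" if "j < T" for j using V(1) that by simp
          show "is_closed_ball B" if "B \<in> \<F>" for B using F(2) that by simp
          show "shatters ((\<lambda>B. {j\<in>{..<T}. hits (V j) B}) ` \<F>) S"
            using \<open>shatters H S\<close> by (simp only: H_def)
        qed fact
      qed simp
      then obtain X where X: "X \<subseteq> {..<T}" "card X \<le> s" "\<forall>h\<in>H. h \<inter> X \<noteq> {}" by blast
      have finX: "finite X" using X(1) finite_subset by blast
      show ?thesis
        unfolding covered_def
      proof (intro exI[of _ "V ` X"] conjI ballI)
        show "finite (V ` X)" using finX by simp
        show "card (V ` X) \<le> s" using card_image_le[OF finX, of V] X(2) by linarith
        show "is_flat k U" if "U \<in> V ` X" for U using that V(1) X(1) by auto
        show "\<exists>U\<in>V ` X. hits U B" if "B \<in> \<F>" for B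
        proof -
          have "{j\<in>{..<T}. hits (V j) B} \<inter> X \<noteq> {}" using X(3) that by (simp add: H_def)
          then show ?thesis by auto
        qed
      qed
    qed
  qed
qed

theorem theorem1p7:
  fixes k p :: nat
  assumes "1 \<le> k" and "k < CARD('n::finite)" and "k + 2 \<le> p"
  shows "\<exists>C::nat. \<forall>\<F> :: (real ^ 'n) set set.
           (\<forall>B\<in>\<F>. is_closed_ball B) \<and> flat_pq_property p (k + 2) k \<F> \<longrightarrow>
           (\<exists>\<T>. finite \<T> \<and> card \<T> \<le> C \<and> (\<forall>V\<in>\<T>. is_flat k V) \<and>
                (\<forall>B\<in>\<F>. \<exists>V\<in>\<T>. hits V B))"
proof -
  have k: "k \<le> CARD('n)" using assms(2) by simp
  obtain C where C: "\<And>\<F> :: (real ^ 'n) set set. finite \<F> \<Longrightarrow> \<forall>B\<in>\<F>. is_closed_ball B \<Longrightarrow>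
    flat_pq_property p (k + 2) k \<F> \<Longrightarrow> covered k C \<F>"
    using finite_families_covered[OF k, of p] by blast
  have "covered k C \<F>"
    if balls: "\<forall>B\<in>\<F>. is_closed_ball B" and pq: "flat_pq_property p (k + 2) k \<F>"
    for \<F> :: "(real ^ 'n) set set"
  proof (rule covered_if_finite_subfamilies_covered[OF k])
    show "is_closed_ball B" if "B \<in> \<F>" for B using balls that by blast
    show "covered k C \<G>" if "\<G> \<subseteq> \<F>" "finite \<G>" for \<G>
    proof (rule C[OF that(2)])
      show "\<forall>B\<in>\<G>. is_closed_ball B" using balls that by blast
      show "flat_pq_property p (k + 2) k \<G>"
        unfolding flat_pq_property_def
      proof (intro allI impI)
        fix \<G>' assume "\<G>' \<subseteq> \<G>" and fin: "finite \<G>' \<and> card \<G>' = p"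
        then have "\<G>' \<subseteq> \<F>" using that(1) by blast
        then show "\<exists>\<H>\<subseteq>\<G>'. card \<H> = k + 2 \<and> (\<exists>V. is_flat k V \<and> (\<forall>B\<in>\<H>. hits V B))"
          by (rule pq[unfolded flat_pq_property_def, THEN spec, THEN mp, THEN mp, OF _ fin])
      qed
    qed
  qed
  then show ?thesis unfolding covered_def by blast
qed

end
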